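(* Let $(R,\mathfrak m)\subset (S,\mathfrak n)$ be an extension of local rings such that $(I:J)S=(IS):(JS)$ for all ideals $I,J\subset R$ (e.g. if $R\to S$ is flat). The following statements are equivalent. (i) $I^{\mathrm{sat}}S=(IS)^{\mathrm{sat}}$ for all ideals $I$ in $R$. (ii) $I^{\mathrm{sat}}S=(IS)^{\mathrm{sat}}$ for some $\mathfrak m$-primary ideal $I$ in $R$. (iii) $\sqrt{\mathfrak mS}=\mathfrak n$. (iv) For some $\mathfrak m$-primary ideal $I$ in $R$, the limit $\lim_{n\to\infty}\ell_S\big((I^n)^{\mathrm{sat}}S/(I^nS)^{\mathrm{sat}}\big)$ exists and equals zero. In particular, $I^{\mathrm{sat}}S=(IS)^{\mathrm{sat}}$ holds for all ideals $I$ in $R$ if the extension $R\subset S$ is étale.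
   Context: Local rings are Noetherian, and an extension of local rings $(R,\mathfrak m)\subset(S,\mathfrak n)$ is an injective local homomorphism ($\mathfrak m\subset\mathfrak n$). For an ideal $K$ of a local ring $(A,\mathfrak m_A)$, the saturation of $K$ is $K^{\mathrm{sat}}=\bigcup_{i\ge 1}(K:_A\mathfrak m_A^i)$; so $I^{\mathrm{sat}}$ is computed in $R$ and $(IS)^{\mathrm{sat}}$ in $S$. $\ell_S$ denotes length of $S$-modules (possibly infinite). An extension $(R,\mathfrak m,k)\subset(S,\mathfrak n,\ell)$ of local rings is unramified if $\mathfrak mS=\mathfrak n$ and $k\to\ell$ is separable algebraic; it is étale (the paper's definition says "formally étale") if it is unramified and flat. *)

theory Defs
  imports "HOL-Algebra.Algebra" "HOL-Library.Extended_Real"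
begin

section \<open>Local rings and their extensions\<close>

locale local_ring = cring R + noetherian_ring R for R (structure) +
  fixes \<mm>
  assumes max_ideal: "maximalideal \<mm> R"
    and max_ideal_unique: "maximalideal I R \<Longrightarrow> I = \<mm>"

locale local_ring_extension = R: local_ring R \<mm> + S: local_ring S \<nn>
  for R :: "('a, 'c) ring_scheme" and \<mm> and S :: "('b, 'd) ring_scheme" and \<nn> +
  fixes \<phi> :: "'a \<Rightarrow> 'b"
  assumes hom: "\<phi> \<in> ring_hom R S"
    and inj: "inj_on \<phi> (carrier R)"
    and local_hom: "\<phi> ` \<mm> \<subseteq> \<nn>"


section \<open>Ideals\<close>

definition colon :: "('a, 'c) ring_scheme \<Rightarrow> 'a set \<Rightarrow> 'a set \<Rightarrow> 'a set"
  where "colon R I J = {x \<in> carrier R. \<forall>y\<in>J. x \<otimes>\<^bsub>R\<^esub> y \<in> I}"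

text \<open>\<^const>\<open>ideals_set\<close> carries the multiplicative monoid of ideals, with neutral element
  \<open>carrier R\<close>.\<close>

definition ideal_power :: "('a, 'c) ring_scheme \<Rightarrow> 'a set \<Rightarrow> nat \<Rightarrow> 'a set"
  where "ideal_power R I k = I [^]\<^bsub>ideals_set R\<^esub> k"

definition saturation :: "('a, 'c) ring_scheme \<Rightarrow> 'a set \<Rightarrow> 'a set \<Rightarrow> 'a set"
  where "saturation R \<mm> I = (\<Union>i\<in>{1..}. colon R I (ideal_power R \<mm> i))"

definition radical :: "('a, 'c) ring_scheme \<Rightarrow> 'a set \<Rightarrow> 'a set"
  where "radical R I = {x \<in> carrier R. \<exists>k::nat. x [^]\<^bsub>R\<^esub> k \<in> I}"

definition primary_ideal :: "('a, 'c) ring_scheme \<Rightarrow> 'a set \<Rightarrow> bool"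
  where "primary_ideal R Q \<longleftrightarrow> ideal Q R \<and> Q \<noteq> carrier R \<and>
    (\<forall>a\<in>carrier R. \<forall>b\<in>carrier R. a \<otimes>\<^bsub>R\<^esub> b \<in> Q \<longrightarrow> a \<in> Q \<or> (\<exists>k::nat. b [^]\<^bsub>R\<^esub> k \<in> Q))"

definition is_primary_to :: "('a, 'c) ring_scheme \<Rightarrow> 'a set \<Rightarrow> 'a set \<Rightarrow> bool"
  where "is_primary_to R \<mm> I \<longleftrightarrow> primary_ideal R I \<and> radical R I = \<mm>"


section \<open>Modules and length\<close>

text \<open>The target of a ring homomorphism as a module over the source.\<close>

definition scalar_module :: "('a \<Rightarrow> 'b) \<Rightarrow> ('b, 'd) ring_scheme \<Rightarrow> ('a, 'b) module"
  where "scalar_module \<phi> S =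
    \<lparr>carrier = carrier S, monoid.mult = monoid.mult S, monoid.one = \<one>\<^bsub>S\<^esub>,
     ring.zero = \<zero>\<^bsub>S\<^esub>, ring.add = ring.add S,
     smult = (\<lambda>r s. \<phi> r \<otimes>\<^bsub>S\<^esub> s)\<rparr>"

definition ideal_module :: "('a, 'c) ring_scheme \<Rightarrow> 'a set \<Rightarrow> ('a, 'a) module"
  where "ideal_module R I = (scalar_module (\<lambda>r. r) R)\<lparr>carrier := I\<rparr>"

text \<open>The record type of modules extends that of rings; the fields \<open>mult\<close> and \<open>one\<close> are
  irrelevant for a module and are left unspecified in a quotient.\<close>

definition quotient_module :: "('r, 'a, 'z) module_scheme \<Rightarrow> 'a set \<Rightarrow> ('r, 'a set) module"
  where "quotient_module M N =
    \<lparr>carrier = a_rcosets\<^bsub>M\<^esub> N, monoid.mult = undefined, monoid.one = undefined,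
     ring.zero = N, ring.add = set_add M,
     smult = (\<lambda>r C. \<Union>x\<in>C. N +>\<^bsub>M\<^esub> (r \<odot>\<^bsub>M\<^esub> x))\<rparr>"

definition module_length :: "('r, 'c) ring_scheme \<Rightarrow> ('r, 'a, 'z) module_scheme \<Rightarrow> enat"
  where "module_length R M = Sup {enat k | k. \<exists>N :: nat \<Rightarrow> 'a set.
    N 0 = {\<zero>\<^bsub>M\<^esub>} \<and> N k = carrier M \<and>
    (\<forall>i\<le>k. submodule (N i) R M) \<and> (\<forall>i<k. N i \<subset> N (Suc i))}"


section \<open>Tensor products and flatness\<close>

definition tensor_relations ::
    "('r, 'c) ring_scheme \<Rightarrow> ('r, 'a, 'y) module_scheme \<Rightarrow> ('r, 'b, 'z) module_scheme
      \<Rightarrow> ('a \<times> 'b \<Rightarrow>\<^sub>0 int) set"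
  where "tensor_relations R M N =
    {frag_of (x \<oplus>\<^bsub>M\<^esub> x', y) - frag_of (x, y) - frag_of (x', y) | x x' y.
       x \<in> carrier M \<and> x' \<in> carrier M \<and> y \<in> carrier N} \<union>
    {frag_of (x, y \<oplus>\<^bsub>N\<^esub> y') - frag_of (x, y) - frag_of (x, y') | x y y'.
       x \<in> carrier M \<and> y \<in> carrier N \<and> y' \<in> carrier N} \<union>
    {frag_of (r \<odot>\<^bsub>M\<^esub> x, y) - frag_of (x, r \<odot>\<^bsub>N\<^esub> y) | r x y.
       r \<in> carrier R \<and> x \<in> carrier M \<and> y \<in> carrier N}"

definition tensor_kernel ::
    "('r, 'c) ring_scheme \<Rightarrow> ('r, 'a, 'y) module_scheme \<Rightarrow> ('r, 'b, 'z) module_scheme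
      \<Rightarrow> ('a \<times> 'b \<Rightarrow>\<^sub>0 int) set"
  where "tensor_kernel R M N =
    generate (free_Abelian_group (carrier M \<times> carrier N)) (tensor_relations R M N)"

text \<open>The underlying abelian group of \<open>M \<otimes>\<^sub>R N\<close>; injectivity of a linear map does not
  involve the scalar action.\<close>

definition tensor_product ::
    "('r, 'c) ring_scheme \<Rightarrow> ('r, 'a, 'y) module_scheme \<Rightarrow> ('r, 'b, 'z) module_scheme
      \<Rightarrow> ('a \<times> 'b \<Rightarrow>\<^sub>0 int) set monoid"
  where "tensor_product R M N =
    free_Abelian_group (carrier M \<times> carrier N) Mod tensor_kernel R M N"

text \<open>The map \<open>f \<otimes> id\<close> from \<open>M \<otimes>\<^sub>R N\<close> to \<open>P \<otimes>\<^sub>R N\<close> induced by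
  an \<open>R\<close>-linear map \<open>f\<close> from \<open>M\<close> to \<open>P\<close>, acting on cosets.\<close>

definition tensor_map ::
    "('r, 'c) ring_scheme \<Rightarrow> ('r, 'p, 'y) module_scheme \<Rightarrow> ('r, 'b, 'z) module_scheme
      \<Rightarrow> ('a \<Rightarrow> 'p) \<Rightarrow> ('a \<times> 'b \<Rightarrow>\<^sub>0 int) set \<Rightarrow> ('p \<times> 'b \<Rightarrow>\<^sub>0 int) set"
  where "tensor_map R P N f C =
    (\<Union>u\<in>C. tensor_kernel R P N #>\<^bsub>free_Abelian_group (carrier P \<times> carrier N)\<^esub>
       frag_extend (\<lambda>(x, y). frag_of (f x, y)) u)"

definition module_homs ::
    "('r, 'c) ring_scheme \<Rightarrow> ('r, 'a, 'y) module_scheme \<Rightarrow> ('r, 'b, 'z) module_scheme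
      \<Rightarrow> ('a \<Rightarrow> 'b) set"
  where "module_homs R M P = {f \<in> carrier M \<rightarrow> carrier P.
    (\<forall>x\<in>carrier M. \<forall>y\<in>carrier M. f (x \<oplus>\<^bsub>M\<^esub> y) = f x \<oplus>\<^bsub>P\<^esub> f y) \<and>
    (\<forall>r\<in>carrier R. \<forall>x\<in>carrier M. f (r \<odot>\<^bsub>M\<^esub> x) = r \<odot>\<^bsub>P\<^esub> f x)}"

text \<open>A definition in HOL cannot quantify over the modules of all types, so the test modules
  \<open>M\<close> and \<open>P\<close> range over the \<open>R\<close>-modules whose elements lie in the type of
  the elements of \<open>R\<close>.  This makes no difference: \<open>R\<close> and its ideals are
  among them, and \<open>N\<close> is flat as soon as the inclusions of ideals in \<open>R\<close> remain
  injective after tensoring with \<open>N\<close>.\<close>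

definition flat_module :: "('a, 'c) ring_scheme \<Rightarrow> ('a, 'b, 'z) module_scheme \<Rightarrow> bool"
  where "flat_module R N \<longleftrightarrow> module R N \<and>
    (\<forall>(M :: ('a, 'a) module) (P :: ('a, 'a) module) f.
       module R M \<and> module R P \<and> f \<in> module_homs R M P \<and> inj_on f (carrier M) \<longrightarrow>
       inj_on (tensor_map R P N f) (carrier (tensor_product R M N)))"

definition flat_hom ::
    "('a, 'c) ring_scheme \<Rightarrow> ('b, 'd) ring_scheme \<Rightarrow> ('a \<Rightarrow> 'b) \<Rightarrow> bool"
  where "flat_hom R S \<phi> \<longleftrightarrow> flat_module R (scalar_module \<phi> S)"


section \<open>Separable, unramified and etale extensions\<close>

text \<open>Polynomials are coefficient lists, leading coefficient first.\<close>

definition (in ring) poly_derivative :: "'a list \<Rightarrow> 'a list"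
  where "poly_derivative p = normalize (map (\<lambda>i::nat. [i] \<cdot> coeff p i) (rev [1..<length p]))"

definition (in ring) separable_poly :: "'a set \<Rightarrow> 'a list \<Rightarrow> bool"
  where "separable_poly K p \<longleftrightarrow>
    (\<forall>q\<in>carrier (K[X]). q divides\<^bsub>K[X]\<^esub> p \<and> q divides\<^bsub>K[X]\<^esub> poly_derivative p
       \<longrightarrow> q \<in> Units (K[X]))"

definition (in ring) separable_algebraic :: "'a set \<Rightarrow> 'a \<Rightarrow> bool"
  where "separable_algebraic K x \<longleftrightarrow> (algebraic over K) x \<and> separable_poly K (Irr K x)"

text \<open>The image in \<open>S Quot \<nn>\<close> of the residue field \<open>R Quot \<mm>\<close>.\<close>

definition residue_subfield ::
    "('a, 'c) ring_scheme \<Rightarrow> ('b, 'd) ring_scheme \<Rightarrow> 'b set \<Rightarrow> ('a \<Rightarrow> 'b) \<Rightarrow> 'b set set"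
  where "residue_subfield R S \<nn> \<phi> = (\<lambda>r. \<nn> +>\<^bsub>S\<^esub> \<phi> r) ` carrier R"

definition unramified ::
    "('a, 'c) ring_scheme \<Rightarrow> 'a set \<Rightarrow> ('b, 'd) ring_scheme \<Rightarrow> 'b set \<Rightarrow> ('a \<Rightarrow> 'b) \<Rightarrow> bool"
  where "unramified R \<mm> S \<nn> \<phi> \<longleftrightarrow> Idl\<^bsub>S\<^esub> (\<phi> ` \<mm>) = \<nn> \<and>
    (\<forall>x\<in>carrier (S Quot \<nn>).
       ring.separable_algebraic (S Quot \<nn>) (residue_subfield R S \<nn> \<phi>) x)"

definition etale ::
    "('a, 'c) ring_scheme \<Rightarrow> 'a set \<Rightarrow> ('b, 'd) ring_scheme \<Rightarrow> 'b set \<Rightarrow> ('a \<Rightarrow> 'b) \<Rightarrow> bool"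
  where "etale R \<mm> S \<nn> \<phi> \<longleftrightarrow> unramified R \<mm> S \<nn> \<phi> \<and> flat_hom R S \<phi>"

end

theory Submission
  imports Defs
begin

text \<open>
  Write \<open>IS\<close> for the extension of an ideal \<open>I\<close> of \<open>R\<close>.  Everything is controlled by one question:
  does some power of \<open>\<nn>\<close> lie in \<open>\<mm>S\<close>?  Since \<open>\<nn>\<close> is finitely generated and \<open>\<mm>S \<subseteq> \<nn>\<close>, this is
  equivalent to (iii), \<open>\<surd>(\<mm>S) = \<nn>\<close>; see \<open>radical_ext_max_iff\<close>.

  If \<open>I\<close> is \<open>\<mm>\<close>-primary, then \<open>I\<close> and all its powers contain powers of \<open>\<mm>\<close>, so the saturation of
  \<open>I^k\<close> is all of \<open>R\<close> and extends to all of \<open>S\<close>.  The saturation of \<open>I^kS\<close> is all of \<open>S\<close> exactly when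
  \<open>I^kS\<close> contains a power of \<open>\<nn>\<close>, and for \<open>k > 0\<close> this happens exactly when \<open>\<mm>S\<close> does
  (\<open>saturation_ext_power_eq_carrier_iff\<close>).  For \<open>k = 1\<close> this identifies (ii) with (iii).  For general
  \<open>k\<close> it identifies (iv) with (iii): zero is an isolated point of the extended natural numbers, so
  lengths can tend to zero only by becoming zero, and the length of \<open>S/J\<close> is zero only for \<open>J = S\<close>.

  For an arbitrary ideal \<open>I\<close>, the inclusions \<open>\<nn>^p \<subseteq> \<mm>S \<subseteq> \<nn>\<close> show that the saturation of \<open>IS\<close> is also
  the union of the ideals \<open>IS : \<mm>^kS\<close>.  If forming colon ideals commutes with extension, these are the
  ideals \<open>(I : \<mm>^k)S\<close>, whose union is the extension of the saturation of \<open>I\<close>.  So (iii) implies (i),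
  and (i) implies (ii) because \<open>\<mm>\<close> itself is \<open>\<mm>\<close>-primary.

  That colon ideals commute with flat extensions (\<open>flat_ext_colon\<close>) is proved from the definition by
  adding the finitely many generators of \<open>J\<close> one at a time.  The step for a generator \<open>y\<close> tests
  flatness on the injection \<open>K/L \<rightarrow> R/I\<close> that multiplication by \<open>y\<close> induces, where \<open>K\<close> is the colon
  ideal reached so far and \<open>L\<close> the set of its elements \<open>a\<close> with \<open>a y \<in> I\<close> (\<open>flat_ext_mem\<close>).  Finally, an
  etale extension is flat and satisfies \<open>\<mm>S = \<nn>\<close>, so (iii) and hence (i) hold.
\<close>

section \<open>Powers, colon ideals and saturation\<close>

context ring
begin

lemma ideal_zero_mem: "ideal I R \<Longrightarrow> \<zero> \<in> I"
  by (simp add: additive_subgroup.zero_closed ideal.axioms(1))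

lemma ideal_add_mem: "ideal I R \<Longrightarrow> x \<in> I \<Longrightarrow> y \<in> I \<Longrightarrow> x \<oplus> y \<in> I"
  by (simp add: additive_subgroup.a_closed ideal.axioms(1))

lemma ideal_subset_carrier: "ideal I R \<Longrightarrow> I \<subseteq> carrier R"
  by (simp add: additive_subgroup.a_subset ideal.axioms(1))

lemma ideal_prod_subset:
  assumes "ideal T R" "\<And>x y. x \<in> I \<Longrightarrow> y \<in> J \<Longrightarrow> x \<otimes> y \<in> T"
  shows "I \<cdot> J \<subseteq> T"
proof
  fix s assume "s \<in> I \<cdot> J"
  then show "s \<in> T"
    by (induction rule: ideal_prod.induct) (auto simp: assms ideal_add_mem)
qed

lemma ideal_prod_mono: "I \<subseteq> I' \<Longrightarrow> J \<subseteq> J' \<Longrightarrow> I \<cdot> J \<subseteq> I' \<cdot> J'"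
proof
  fix s assume "s \<in> I \<cdot> J" "I \<subseteq> I'" "J \<subseteq> J'"
  then show "s \<in> I' \<cdot> J'"
    by (induction rule: ideal_prod.induct) (auto intro: ideal_prod.intros)
qed

lemma set_add_mem_iff: "x \<in> I <+>\<^bsub>R\<^esub> J \<longleftrightarrow> (\<exists>a\<in>I. \<exists>b\<in>J. x = a \<oplus> b)"
  by (auto simp: set_add_def')

end

context cring
begin

lemma ideal_power_0 [simp]: "ideal_power R I 0 = carrier R"
  by (simp add: ideal_power_def ideals_set_def)

lemma ideal_power_Suc [simp]: "ideal_power R I (Suc k) = ideal_power R I k \<cdot> I"
  by (simp add: ideal_power_def) (simp add: ideals_set_def)

lemma ideal_power_ideal: "ideal I R \<Longrightarrow> ideal (ideal_power R I k) R"
  by (induction k) (auto simp: oneideal ideal_prod_is_ideal)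

lemma ideal_power_1: "ideal I R \<Longrightarrow> ideal_power R I (Suc 0) = I"
  by (simp add: ideal_prod_commute[OF oneideal] ideal_prod_one)

lemma ideal_power_mult:
  assumes "ideal I R"
  shows "ideal_power R (ideal_power R I j) k = ideal_power R I (j * k)"
  using monoid.nat_pow_pow[OF comm_monoid.axioms(1)[OF ideals_set_is_comm_monoid], of I j k] assms
  by (simp add: ideal_power_def ideals_set_def mult.commute)

lemma ideal_power_mono: "I \<subseteq> J \<Longrightarrow> ideal_power R I k \<subseteq> ideal_power R J k"
  by (induction k) (auto simp: ideal_prod_mono)

lemma ideal_power_Suc_subset:
  assumes "ideal I R"
  shows "ideal_power R I (Suc k) \<subseteq> ideal_power R I k" "ideal_power R I (Suc k) \<subseteq> I"
  using ideal_prod_inter[OF ideal_power_ideal[OF assms] assms, of k] by auto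

lemma ideal_power_antimono:
  assumes "ideal I R" "j \<le> k"
  shows "ideal_power R I k \<subseteq> ideal_power R I j"
  using assms(2) by (induction k rule: dec_induct) (use ideal_power_Suc_subset[OF assms(1)] in blast)+

lemma nat_pow_mem_ideal_power:
  "x \<in> I \<Longrightarrow> I \<subseteq> carrier R \<Longrightarrow> x [^] (k::nat) \<in> ideal_power R I k"
  by (induction k) (auto intro: ideal_prod.prod)

text \<open>A product of \<open>k + l\<close> factors from \<open>B + C\<close> expands into products that contain at least
  \<open>k\<close> factors from \<open>B\<close> or at least \<open>l\<close> factors from \<open>C\<close>.  The double induction splits off
  one factor: if it lies in \<open>B\<close>, the remaining \<open>k + (l + 1)\<close> factors are treated by the
  hypothesis for \<open>k\<close>; if it lies in \<open>C\<close>, they are treated as \<open>(k + 1) + l\<close> factors by the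
  hypothesis for \<open>l\<close>.\<close>

lemma ideal_power_sum_subset:
  assumes B: "ideal B R" and C: "ideal C R"
  shows "ideal_power R (B <+>\<^bsub>R\<^esub> C) (k + l) \<subseteq> ideal_power R B k <+>\<^bsub>R\<^esub> ideal_power R C l"
proof (induction k arbitrary: l)
  case 0
  show ?case
    using ideal_power_ideal[OF add_ideals[OF B C]] ideal_power_ideal[OF C]
      ideal_subset_carrier ideal_zero_mem
    by (force simp: set_add_mem_iff subset_iff dest: ideal.Icarr)
next
  case (Suc k)
  note IHk = Suc.IH
  show ?case
  proof (induction l)
    case 0
    show ?case
      using ideal_power_ideal[OF add_ideals[OF B C], of "Suc k"] ideal_power_ideal[OF B, of "Suc k"]
      unfolding ideal_power_0 add_0_right
      by (metis (no_types, lifting) ideal.Icarr ideal_zero_mem l_zero set_add_mem_iff subsetI)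
  next
    case (Suc l)
    let ?X = "ideal_power R (B <+>\<^bsub>R\<^esub> C) (Suc (k + l))"
    let ?T = "ideal_power R B (Suc k) <+>\<^bsub>R\<^esub> ideal_power R C (Suc l)"
    note ids = ideal_power_ideal[OF B] ideal_power_ideal[OF C]
    have T: "ideal ?T R"
      by (intro add_ideals ids)
    have TB: "ideal_power R B (Suc k) \<subseteq> ?T"
      using ideal_zero_mem[OF ids(2), of "Suc l"] ideal.Icarr[OF ids(1)]
      by (metis (no_types, lifting) r_zero set_add_mem_iff subsetI)
    have TC: "ideal_power R C (Suc l) \<subseteq> ?T"
      using ideal_zero_mem[OF ids(1), of "Suc k"] ideal.Icarr[OF ids(2)]
      by (metis (no_types, lifting) l_zero set_add_mem_iff subsetI)
    have "x \<otimes> b \<in> ?T" if x: "x \<in> ?X" and b: "b \<in> B" for x b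
    proof -
      obtain p q where pq: "p \<in> ideal_power R B k" "q \<in> ideal_power R C (Suc l)" "x = p \<oplus> q"
        using IHk[of "Suc l"] x
        by (auto simp: set_add_mem_iff subset_iff)
      have c: "p \<in> carrier R" "q \<in> carrier R" "b \<in> carrier R"
        using pq b ideal.Icarr[OF ids(1)] ideal.Icarr[OF ids(2)] ideal.Icarr[OF B] by blast+
      have 1: "p \<otimes> b \<in> ?T"
        using TB ideal_prod.prod[OF pq(1) b] by auto
      have 2: "q \<otimes> b \<in> ?T"
        using TC ideal.I_r_closed[OF ids(2) pq(2) c(3)] by blast
      show ?thesis
        using ideal_add_mem[OF T 1 2] c pq(3) by (simp add: l_distr)
    qed
    moreover have "x \<otimes> c \<in> ?T" if x: "x \<in> ?X" and c: "c \<in> C" for x c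
    proof -
      obtain p q where pq: "p \<in> ideal_power R B (Suc k)" "q \<in> ideal_power R C l" "x = p \<oplus> q"
        using Suc.IH x by (auto simp: set_add_mem_iff subset_iff)
      have cc: "p \<in> carrier R" "q \<in> carrier R" "c \<in> carrier R"
        using pq c ideal.Icarr[OF ids(1)] ideal.Icarr[OF ids(2)] ideal.Icarr[OF C] by blast+
      have 2: "q \<otimes> c \<in> ?T"
        using TC ideal_prod.prod[OF pq(2) c] by auto
      have 1: "p \<otimes> c \<in> ?T"
        using TB ideal.I_r_closed[OF ids(1) pq(1) cc(3)] by blast
      show ?thesis
        using ideal_add_mem[OF T 1 2] cc pq(3) by (simp add: l_distr)
    qed
    moreover have "?X \<subseteq> carrier R"
      by (intro ideal_subset_carrier ideal_power_ideal add_ideals B C)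
    ultimately have "x \<otimes> s \<in> ?T" if "x \<in> ?X" "s \<in> B <+>\<^bsub>R\<^esub> C" for x s
      using that ideal_add_mem[OF T] ideal_subset_carrier[OF B] ideal_subset_carrier[OF C]
      by (auto simp: set_add_mem_iff subset_iff r_distr)
    then have "?X \<cdot> (B <+>\<^bsub>R\<^esub> C) \<subseteq> ?T"
      by (intro ideal_prod_subset T)
    then show ?case
      by simp
  qed
qed

lemma cgenideal_power_subset:
  assumes "a \<in> carrier R" "ideal I R" "a [^] k \<in> I"
  shows "ideal_power R (PIdl a) k \<subseteq> I"
proof -
  have "ideal_power R (PIdl a) k \<subseteq> PIdl (a [^] k)"
  proof (induction k)
    case 0
    then show ?case
      by (auto simp: cgenideal_def intro: r_one[symmetric])
  next
    case (Suc k)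
    show ?case
      unfolding ideal_power_Suc
    proof (rule ideal_prod_subset)
      show "ideal (PIdl (a [^] Suc k)) R"
        using assms(1) by (intro cgenideal_ideal) simp
    next
      fix x y assume x: "x \<in> ideal_power R (PIdl a) k" and "y \<in> PIdl a"
      then obtain r s where "r \<in> carrier R" "s \<in> carrier R" "x = r \<otimes> a [^] k" "y = s \<otimes> a"
        using Suc by (auto simp: cgenideal_def subset_iff)
      then have "x \<otimes> y = (r \<otimes> s) \<otimes> a [^] Suc k"
        using assms(1) by (simp add: m_ac)
      then show "x \<otimes> y \<in> PIdl (a [^] Suc k)"
        using \<open>r \<in> _\<close> \<open>s \<in> _\<close> by (auto simp: cgenideal_def)
    qed
  qed
  then show ?thesis
    using cgenideal_minimal[OF assms(2,3)] by blast
qed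

text \<open>Generators are added one at a time: a power of the principal ideal of the new generator and
  a power of the ideal of the old ones both lie in \<open>I\<close>, so a power of their sum does.\<close>

lemma radical_finite_power_subset:
  assumes "finite A" "A \<subseteq> radical R I" "ideal I R"
  shows "\<exists>k. ideal_power R (Idl A) k \<subseteq> I"
  using assms(1,2)
proof (induction A rule: finite_induct)
  case empty
  have "Idl {} \<subseteq> I"
    by (rule genideal_minimal[OF assms(3)]) simp
  then show ?case
    using ideal_power_1[OF genideal_ideal, of "{}"] by (metis empty_subsetI)
next
  case (insert a A)
  then obtain l where l: "ideal_power R (Idl A) l \<subseteq> I"
    by blast
  obtain k :: nat where a: "a \<in> carrier R" and k: "a [^] k \<in> I"
    using insert.prems by (auto simp: radical_def)
  have A: "A \<subseteq> carrier R"
    using insert.prems by (auto simp: radical_def)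
  have idA: "ideal (Idl A) R" and ida: "ideal (PIdl a) R"
    using A a genideal_ideal cgenideal_ideal by auto
  have "insert a A \<subseteq> PIdl a \<union> Idl A"
    using genideal_self[OF A] cgenideal_self[OF a] by blast
  also have "\<dots> \<subseteq> PIdl a <+>\<^bsub>R\<^esub> Idl A"
    unfolding union_genideal[OF ida idA, symmetric]
    using ideal_subset_carrier[OF ida] ideal_subset_carrier[OF idA] by (intro genideal_self) blast
  finally have "Idl (insert a A) \<subseteq> PIdl a <+>\<^bsub>R\<^esub> Idl A"
    by (intro genideal_minimal add_ideals ida idA)
  then have "ideal_power R (Idl (insert a A)) (k + l)
      \<subseteq> ideal_power R (PIdl a) k <+>\<^bsub>R\<^esub> ideal_power R (Idl A) l"
    using ideal_power_mono ideal_power_sum_subset[OF ida idA] by blast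
  also have "\<dots> \<subseteq> I"
    using cgenideal_power_subset[OF a assms(3) k] l ideal_add_mem[OF assms(3)]
    by (auto simp: set_add_mem_iff subset_iff)
  finally show ?case by blast
qed

lemma colon_ideal:
  assumes "ideal I R" "J \<subseteq> carrier R"
  shows "ideal (colon R I J) R"
proof (rule idealI[OF ring_axioms])
  interpret I: ideal I R by fact
  show "subgroup (colon R I J) (add_monoid R)"
  proof (rule group.subgroupI[OF a_group])
    show "colon R I J \<noteq> {}"
      using assms(2) by (auto simp: colon_def subset_iff intro!: exI[of _ \<zero>])
    fix a assume "a \<in> colon R I J"
    then show "inv\<^bsub>add_monoid R\<^esub> a \<in> colon R I J"
      using assms(2) unfolding a_inv_def[symmetric] by (auto simp: colon_def subset_iff l_minus)
  qed (use assms(2) in \<open>auto simp: colon_def subset_iff l_distr\<close>)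
next
  fix a x assume a: "a \<in> colon R I J" and x: "x \<in> carrier R"
  show "x \<otimes> a \<in> colon R I J"
    using a x assms by (auto simp: colon_def subset_iff m_assoc intro: ideal.I_l_closed)
  then show "a \<otimes> x \<in> colon R I J"
    using a x by (simp add: colon_def m_comm)
qed

text \<open>For a fixed \<open>x\<close> the elements that \<open>x\<close> multiplies into \<open>I\<close> form an ideal, namely
  \<open>I : x\<close>, so it suffices to test the generators.\<close>

lemma colon_genideal:
  assumes I: "ideal I R" and A: "A \<subseteq> carrier R"
  shows "colon R I (Idl A) = colon R I A"
proof
  show "colon R I (Idl A) \<subseteq> colon R I A"
    using genideal_self[OF A] by (auto simp: colon_def)
  show "colon R I A \<subseteq> colon R I (Idl A)"
  proof
    fix x assume x: "x \<in> colon R I A"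
    then have xc: "x \<in> carrier R" by (simp add: colon_def)
    have "A \<subseteq> colon R I {x}"
      using x A by (auto simp: colon_def subset_iff m_comm[of x])
    then have "Idl A \<subseteq> colon R I {x}"
      using genideal_minimal colon_ideal[OF I] xc by simp
    then show "x \<in> colon R I (Idl A)"
      using xc by (auto simp: colon_def subset_iff m_comm)
  qed
qed

lemma colon_mono: "J' \<subseteq> J \<Longrightarrow> colon R I J \<subseteq> colon R I J'"
  by (auto simp: colon_def)

text \<open>The union defining the saturation starts at exponent \<open>1\<close>.  The colon ideals grow with the
  exponent, so a witness at exponent \<open>0\<close> yields one at exponent \<open>1\<close>.\<close>

lemma mem_saturation_iff:
  assumes "ideal N R" "ideal I R"
  shows "x \<in> saturation R N I \<longleftrightarrow> (\<exists>k. x \<in> colon R I (ideal_power R N k))"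
  using colon_mono[OF ideal_power_Suc_subset(1)[OF assms(1)]]
  unfolding saturation_def by fastforce

lemma saturation_ideal:
  assumes N: "ideal N R" and I: "ideal I R"
  shows "ideal (saturation R N I) R"
proof (rule idealI[OF ring_axioms])
  have c: "ideal (colon R I (ideal_power R N k)) R" for k
    by (intro colon_ideal I ideal_subset_carrier ideal_power_ideal N)
  note iff = mem_saturation_iff[OF N I]
  show "subgroup (saturation R N I) (add_monoid R)"
  proof (rule group.subgroupI[OF a_group])
    show "saturation R N I \<subseteq> carrier (add_monoid R)"
      using ideal.Icarr[OF c] by (auto simp: iff)
    show "saturation R N I \<noteq> {}"
      using ideal_zero_mem[OF c] iff by blast
    fix a assume a: "a \<in> saturation R N I"
    then show "inv\<^bsub>add_monoid R\<^esub> a \<in> saturation R N I"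
      using additive_subgroup.a_inv_closed[OF ideal.axioms(1)[OF c]] a_group
      unfolding a_inv_def[symmetric] by (auto simp: iff)
    fix b assume b: "b \<in> saturation R N I"
    obtain k l where "a \<in> colon R I (ideal_power R N k)" "b \<in> colon R I (ideal_power R N l)"
      using a b by (auto simp: iff)
    then have "a \<in> colon R I (ideal_power R N (max k l))" "b \<in> colon R I (ideal_power R N (max k l))"
      using colon_mono[OF ideal_power_antimono[OF N]] by (meson max.cobounded1 max.cobounded2 subsetD)+
    then show "a \<otimes>\<^bsub>add_monoid R\<^esub> b \<in> saturation R N I"
      using ideal_add_mem[OF c] by (auto simp: iff)
  qed
next
  fix a x assume "a \<in> saturation R N I" and x: "x \<in> carrier R"
  then obtain k where k: "a \<in> colon R I (ideal_power R N k)"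
    by (auto simp: mem_saturation_iff[OF N I])
  have "ideal (colon R I (ideal_power R N k)) R"
    by (intro colon_ideal I ideal_subset_carrier ideal_power_ideal N)
  then show "x \<otimes> a \<in> saturation R N I" "a \<otimes> x \<in> saturation R N I"
    using k x ideal.I_l_closed ideal.I_r_closed by (fastforce simp: mem_saturation_iff[OF N I])+
qed

lemma saturation_eq_carrier_iff:
  assumes N: "ideal N R" and I: "ideal I R"
  shows "saturation R N I = carrier R \<longleftrightarrow> (\<exists>k. ideal_power R N k \<subseteq> I)"
proof -
  have "saturation R N I = carrier R \<longleftrightarrow> \<one> \<in> saturation R N I"
    using ideal.one_imp_carrier[OF saturation_ideal[OF N I]] by auto
  also have "\<dots> \<longleftrightarrow> (\<exists>k. ideal_power R N k \<subseteq> I)"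
    using ideal_subset_carrier[OF ideal_power_ideal[OF N]]
    by (auto simp: mem_saturation_iff[OF N I] colon_def subset_iff)
  finally show ?thesis .
qed

end

section \<open>Extension of ideals along a ring homomorphism\<close>

context ring_hom_cring
begin

abbreviation ext :: "'a set \<Rightarrow> 'c set" where
  "ext I \<equiv> Idl\<^bsub>S\<^esub> (h ` I)"

lemma ext_ideal: "I \<subseteq> carrier R \<Longrightarrow> ideal (ext I) S"
  by (intro S.genideal_ideal) auto

lemma mem_ext: "I \<subseteq> carrier R \<Longrightarrow> x \<in> I \<Longrightarrow> h x \<in> ext I"
  using S.genideal_self[of "h ` I"] by auto

lemma ext_subset: "ideal J S \<Longrightarrow> (\<And>x. x \<in> I \<Longrightarrow> h x \<in> J) \<Longrightarrow> ext I \<subseteq> J"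
  by (intro S.genideal_minimal) auto

lemma ext_mono: "J \<subseteq> carrier R \<Longrightarrow> I \<subseteq> J \<Longrightarrow> ext I \<subseteq> ext J"
  by (intro ext_subset ext_ideal mem_ext) auto

lemma ext_carrier: "ext (carrier R) = carrier S"
  using ideal.one_imp_carrier[OF ext_ideal, of "carrier R"] mem_ext[of "carrier R" \<one>] by simp

lemma colon_ext:
  assumes "ideal I R" "J \<subseteq> carrier R"
  shows "colon S (ext I) (ext J) = {s \<in> carrier S. \<forall>y\<in>J. s \<otimes>\<^bsub>S\<^esub> h y \<in> ext I}"
  using S.colon_genideal[OF ext_ideal[OF R.ideal_subset_carrier[OF assms(1)]], of "h ` J"] assms(2)
  by (auto simp: colon_def)

lemma ext_colon_subset:
  assumes "ideal I R" "J \<subseteq> carrier R"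
  shows "ext (colon R I J) \<subseteq> colon S (ext I) (ext J)"
proof (rule ext_subset)
  have I: "I \<subseteq> carrier R"
    using R.ideal_subset_carrier[OF assms(1)] .
  show "ideal (colon S (ext I) (ext J)) S"
    by (intro S.colon_ideal S.ideal_subset_carrier ext_ideal I assms(2))
  fix x assume "x \<in> colon R I J"
  then show "h x \<in> colon S (ext I) (ext J)"
    using mem_ext[OF I] assms(2) unfolding colon_ext[OF assms]
    by (auto simp: colon_def subset_iff simp flip: hom_mult)
qed

text \<open>Computing with sums of products is avoided in the inclusion from right to left by two
  passages through colon ideals: \<open>IS \<cdot> JS \<subseteq> (IJ)S\<close> says that \<open>IS\<close> lies in the ideal
  \<open>(IJ)S : JS\<close>, which can be tested on generators of both factors.\<close>

lemma ext_prod: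
  assumes "ideal I R" "ideal J R"
  shows "ext (I \<cdot>\<^bsub>R\<^esub> J) = ext I \<cdot>\<^bsub>S\<^esub> ext J"
proof
  have I: "I \<subseteq> carrier R" and J: "J \<subseteq> carrier R" and IJ: "I \<cdot>\<^bsub>R\<^esub> J \<subseteq> carrier R"
    using assms by (simp_all add: R.ideal_subset_carrier R.ideal_prod_in_carrier)
  have I': "ideal (ext I) S" and J': "ideal (ext J) S"
    using I J ext_ideal by auto
  have "h x \<in> ext I \<cdot>\<^bsub>S\<^esub> ext J" if "x \<in> I \<cdot>\<^bsub>R\<^esub> J" for x
    using that
  proof (induction rule: ideal_prod.induct)
    case (prod i j)
    then show ?case
      using I J by (auto simp: subset_iff intro!: ideal_prod.prod mem_ext)
  next
    case (sum x y)
    then show ?case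
      using IJ by (auto simp: subset_iff intro!: ideal_prod.sum)
  qed
  then show "ext (I \<cdot>\<^bsub>R\<^esub> J) \<subseteq> ext I \<cdot>\<^bsub>S\<^esub> ext J"
    by (intro ext_subset S.ideal_prod_is_ideal I' J')
  have c: "ideal (colon S (ext (I \<cdot>\<^bsub>R\<^esub> J)) T) S" if "T \<subseteq> carrier S" for T
    using that by (intro S.colon_ideal ext_ideal IJ)
  have "h x \<otimes>\<^bsub>S\<^esub> h y \<in> ext (I \<cdot>\<^bsub>R\<^esub> J)" if "x \<in> I" "y \<in> J" for x y
    using that I J mem_ext[OF IJ ideal_prod.prod[OF that]] by (auto simp: subset_iff)
  then have "h ` I \<subseteq> colon S (ext (I \<cdot>\<^bsub>R\<^esub> J)) (h ` J)"
    using I by (auto simp: colon_def)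
  then have "ext I \<subseteq> colon S (ext (I \<cdot>\<^bsub>R\<^esub> J)) (h ` J)"
    using J by (intro S.genideal_minimal c) auto
  also have "\<dots> = colon S (ext (I \<cdot>\<^bsub>R\<^esub> J)) (ext J)"
    using J by (intro S.colon_genideal[symmetric] ext_ideal IJ) auto
  finally show "ext I \<cdot>\<^bsub>S\<^esub> ext J \<subseteq> ext (I \<cdot>\<^bsub>R\<^esub> J)"
    by (intro S.ideal_prod_subset ext_ideal IJ) (auto simp: colon_def)
qed

lemma ext_power:
  assumes "ideal I R"
  shows "ext (ideal_power R I k) = ideal_power S (ext I) k"
  by (induction k) (simp_all add: ext_carrier ext_prod R.ideal_power_ideal assms)

text \<open>If \<open>x M^k \<subseteq> I\<close>, then \<open>h x\<close> multiplies \<open>(MS)^k\<close>, and therefore \<open>N^(p k)\<close>, into \<open>IS\<close>.\<close>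

lemma ext_saturation_subset:
  assumes M: "ideal M R" and N: "ideal N S" and I: "ideal I R"
    and p: "ideal_power S N p \<subseteq> ext M"
  shows "ext (saturation R M I) \<subseteq> saturation S N (ext I)"
proof (rule ext_subset)
  have I': "ideal (ext I) S"
    by (intro ext_ideal R.ideal_subset_carrier I)
  show "ideal (saturation S N (ext I)) S"
    by (intro S.saturation_ideal N I')
  fix x assume "x \<in> saturation R M I"
  then obtain k where k: "x \<in> colon R I (ideal_power R M k)"
    by (auto simp: R.mem_saturation_iff[OF M I])
  have "h x \<in> ext (colon R I (ideal_power R M k))"
    using k by (intro mem_ext) (auto simp: colon_def)
  also have "\<dots> \<subseteq> colon S (ext I) (ideal_power S (ext M) k)"
    using ext_colon_subset[OF I, of "ideal_power R M k"] ext_power[OF M]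
      R.ideal_subset_carrier[OF R.ideal_power_ideal[OF M]] by simp
  also have "\<dots> \<subseteq> colon S (ext I) (ideal_power S (ideal_power S N p) k)"
    by (intro S.colon_mono S.ideal_power_mono p)
  also have "\<dots> = colon S (ext I) (ideal_power S N (p * k))"
    by (simp add: S.ideal_power_mult[OF N])
  finally show "h x \<in> saturation S N (ext I)"
    by (auto simp: S.mem_saturation_iff[OF N I'])
qed

text \<open>An element \<open>x\<close> with \<open>x N^k \<subseteq> IS\<close> also satisfies \<open>x (M^k S) \<subseteq> IS\<close>, so the assumption on
  colon ideals, applied to \<open>J = M^k\<close>, puts it into \<open>(I : M^k)S\<close>.\<close>

lemma saturation_subset_ext:
  assumes M: "ideal M R" and N: "ideal N S" and I: "ideal I R"
    and MN: "ext M \<subseteq> N"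
    and colon: "\<And>J. ideal J R \<Longrightarrow> colon S (ext I) (ext J) \<subseteq> ext (colon R I J)"
  shows "saturation S N (ext I) \<subseteq> ext (saturation R M I)"
proof
  have I': "ideal (ext I) S"
    by (intro ext_ideal R.ideal_subset_carrier I)
  fix x assume "x \<in> saturation S N (ext I)"
  then obtain k where "x \<in> colon S (ext I) (ideal_power S N k)"
    by (auto simp: S.mem_saturation_iff[OF N I'])
  also have "\<dots> \<subseteq> colon S (ext I) (ideal_power S (ext M) k)"
    by (intro S.colon_mono S.ideal_power_mono MN)
  also have "\<dots> = colon S (ext I) (ext (ideal_power R M k))"
    by (simp add: ext_power[OF M])
  also have "\<dots> \<subseteq> ext (colon R I (ideal_power R M k))"
    by (intro colon R.ideal_power_ideal M)
  also have "\<dots> \<subseteq> ext (saturation R M I)"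
    using R.mem_saturation_iff[OF M I] R.saturation_ideal[OF M I]
    by (intro ext_mono R.ideal_subset_carrier) auto
  finally show "x \<in> ext (saturation R M I)" .
qed

end

section \<open>Modules of length zero\<close>

lemma quotient_module_simps:
  "carrier (quotient_module (ideal_module S (carrier S)) J) = a_rcosets\<^bsub>S\<^esub> J"
  "\<zero>\<^bsub>quotient_module (ideal_module S (carrier S)) J\<^esub> = J"
  "C \<oplus>\<^bsub>quotient_module (ideal_module S (carrier S)) J\<^esub> D = C <+>\<^bsub>S\<^esub> D"
  "r \<odot>\<^bsub>quotient_module (ideal_module S (carrier S)) J\<^esub> C = (\<Union>x\<in>C. J +>\<^bsub>S\<^esub> (r \<otimes>\<^bsub>S\<^esub> x))"
  by (simp_all add: quotient_module_def ideal_module_def scalar_module_def A_RCOSETS_def'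
      a_r_coset_def' set_add_def' fun_eq_iff)

context cring
begin

text \<open>These are the two submodules from which a chain of length one in \<open>R/J\<close> is built.  For
  them to be submodules, \<open>R/J\<close> has to be an additive group on which the scalar action is well
  defined.\<close>

lemma quotient_module_submodules:
  assumes J: "ideal J R"
  defines "M \<equiv> quotient_module (ideal_module R (carrier R)) J"
  shows "submodule {J} R M" "submodule (carrier M) R M"
proof -
  interpret J: ideal J R by fact
  have coset: "C \<in> a_rcosets J \<longleftrightarrow> (\<exists>x\<in>carrier R. C = J +> x)" for C
    by (auto simp: A_RCOSETS_def')
  have J0: "J = J +> \<zero>"
    using a_rcos_zero[OF J] J.zero_closed by simp
  have smult: "r \<odot>\<^bsub>M\<^esub> (J +> a) = J +> (r \<otimes> a)" if "r \<in> carrier R" "a \<in> carrier R" for r a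
  proof -
    have "J +> (r \<otimes> x) = J +> (r \<otimes> a)" if x: "x \<in> J +> a" for x
    proof -
      obtain j where "j \<in> J" "x = j \<oplus> a"
        using x by (auto simp: a_r_coset_def')
      then have "r \<otimes> x = r \<otimes> j \<oplus> r \<otimes> a"
        using \<open>r \<in> _\<close> \<open>a \<in> _\<close> by (simp add: r_distr)
      then show ?thesis
        using J.a_rcos_sum[of "r \<otimes> j" "r \<otimes> a"] J.I_l_closed[OF \<open>j \<in> J\<close> \<open>r \<in> _\<close>] J0
          a_rcos_zero[OF J, of "r \<otimes> j"] J.a_rcos_sum[of \<zero> "r \<otimes> a"] \<open>r \<in> _\<close> \<open>a \<in> _\<close>
        by (auto dest: J.Icarr)
    qed
    moreover have "a \<in> J +> a"
      using J.zero_closed \<open>a \<in> _\<close> by (force simp: a_r_coset_def')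
    ultimately show ?thesis
      unfolding M_def quotient_module_simps by blast
  qed
  have grp: "group (add_monoid M)"
  proof (rule groupI)
    fix x y z assume "x \<in> carrier (add_monoid M)" "y \<in> carrier (add_monoid M)" "z \<in> carrier (add_monoid M)"
    then obtain a b c where "a \<in> carrier R" "b \<in> carrier R" "c \<in> carrier R"
      "x = J +> a" "y = J +> b" "z = J +> c"
      by (auto simp: M_def quotient_module_simps coset)
    then show "x \<otimes>\<^bsub>add_monoid M\<^esub> y \<otimes>\<^bsub>add_monoid M\<^esub> z = x \<otimes>\<^bsub>add_monoid M\<^esub> (y \<otimes>\<^bsub>add_monoid M\<^esub> z)"
      by (simp add: M_def quotient_module_simps J.a_rcos_sum a_assoc)
  next
    fix x assume "x \<in> carrier (add_monoid M)"
    then obtain a where a: "a \<in> carrier R" "x = J +> a"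
      by (auto simp: M_def quotient_module_simps coset)
    then show "\<one>\<^bsub>add_monoid M\<^esub> \<otimes>\<^bsub>add_monoid M\<^esub> x = x"
      using J.a_rcos_sum[of \<zero> a] J0 by (simp add: M_def quotient_module_simps)
    show "\<exists>y\<in>carrier (add_monoid M). y \<otimes>\<^bsub>add_monoid M\<^esub> x = \<one>\<^bsub>add_monoid M\<^esub>"
      using a J.a_rcos_sum[of "\<ominus> a" a] J0
      by (auto simp: M_def quotient_module_simps coset l_neg intro!: bexI[of _ "J +> \<ominus> a"] bexI[of _ "\<ominus> a"])
  qed (use J0 in \<open>auto simp: M_def quotient_module_simps coset J.a_rcos_sum\<close>)
  show "submodule (carrier M) R M"
  proof (intro submodule.intro submodule_axioms.intro)
    show "subgroup (carrier M) (add_monoid M)"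
      using group.subgroup_self[OF grp] by simp
    fix r x assume r: "r \<in> carrier R" and "x \<in> carrier M"
    then obtain a where a: "a \<in> carrier R" "x = J +> a"
      by (auto simp: M_def quotient_module_simps coset)
    then have "r \<otimes> a \<in> carrier R" "r \<odot>\<^bsub>M\<^esub> x = J +> (r \<otimes> a)"
      using r smult by auto
    then show "r \<odot>\<^bsub>M\<^esub> x \<in> carrier M"
      unfolding M_def quotient_module_simps coset by blast
  qed
  show "submodule {J} R M"
  proof (intro submodule.intro submodule_axioms.intro)
    show "subgroup {J} (add_monoid M)"
      using group.triv_subgroup[OF grp] by (simp add: M_def quotient_module_simps)
    show "r \<odot>\<^bsub>M\<^esub> x \<in> {J}" if "r \<in> carrier R" "x \<in> {J}" for r x
      using that smult[of r \<zero>] J0 by auto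
  qed
qed

text \<open>A chain of length at least one is available as soon as \<open>R/J\<close> is nonzero, namely
  \<open>0 \<subset> R/J\<close>; the zero module only has the chain of length zero.\<close>

lemma length_quotient_eq_0_iff:
  assumes J: "ideal J R"
  shows "module_length R (quotient_module (ideal_module R (carrier R)) J) = 0 \<longleftrightarrow> J = carrier R"
proof -
  let ?M = "quotient_module (ideal_module R (carrier R)) J"
  interpret J: ideal J R by fact
  have J0: "J \<in> carrier ?M"
    using a_rcos_zero[OF J J.zero_closed] by (auto simp: quotient_module_simps A_RCOSETS_def')
  show ?thesis
  proof
    assume len: "module_length R ?M = 0"
    have "carrier ?M = {J}"
    proof (rule ccontr)
      assume ne: "carrier ?M \<noteq> {J}"
      let ?N = "\<lambda>i::nat. if i = 0 then {J} else carrier ?M"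
      have "enat 1 \<le> module_length R ?M"
        unfolding module_length_def
      proof (intro Sup_upper CollectI exI conjI)
        show "?N 0 = {\<zero>\<^bsub>?M\<^esub>}" "?N 1 = carrier ?M"
          by (simp_all add: quotient_module_simps)
        show "\<forall>i\<le>1. submodule (?N i) R ?M"
          using quotient_module_submodules[OF J] by simp
        show "\<forall>i<1. ?N i \<subset> ?N (Suc i)"
          using ne J0 by auto
      qed simp
      then show False
        using len by (simp add: zero_enat_def)
    qed
    then have "J +> x = J" if "x \<in> carrier R" for x
      using that by (auto simp: quotient_module_simps A_RCOSETS_def' set_eq_iff)
    then show "J = carrier R"
      using J.rcos_const_imp_mem J.Icarr by blast
  next
    assume Jc: "J = carrier R"
    then have c: "carrier ?M = {J}"
      using a_rcos_zero[OF J] by (auto simp: quotient_module_simps A_RCOSETS_def')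
    have "k = 0" if "N 0 = {\<zero>\<^bsub>?M\<^esub>}" "N k = carrier ?M" "\<forall>i\<le>k. submodule (N i) R ?M"
      "\<forall>i<k. N i \<subset> N (Suc i)" for k and N :: "nat \<Rightarrow> 'a set set"
    proof (rule ccontr)
      assume "k \<noteq> 0"
      moreover have "N i \<subset> N k" if "i < k" for i
        by (rule less_Suc_induct[of i k "\<lambda>i j. j \<le> k \<longrightarrow> N i \<subset> N j", rule_format])
          (use that \<open>\<forall>i<k. N i \<subset> N (Suc i)\<close> in auto)
      ultimately have "N 0 \<subset> N k" by simp
      then show False
        using that(1,2) c by (simp add: quotient_module_simps)
    qed
    then have "module_length R ?M \<le> 0"
      unfolding module_length_def by (intro Sup_least) (auto simp: zero_enat_def)
    then show "module_length R ?M = 0" by simp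
  qed
qed

end

section \<open>Tensor products over a flat module\<close>

text \<open>The kernel of \<open>\<int>[M \<times> N] \<rightarrow> M \<otimes> N\<close> is used through the following closure properties and
  the fact that it is the least subgroup having them.\<close>

context
  fixes R :: "('r, 'c) ring_scheme" and M :: "('r, 'a, 'y) module_scheme"
    and N :: "('r, 'b, 'z) module_scheme"
  assumes M: "module R M" and N: "module R N"
begin

lemma tensor_relations_subset:
  "tensor_relations R M N \<subseteq> carrier (free_Abelian_group (carrier M \<times> carrier N))"
proof -
  interpret M: module R M by (rule M)
  interpret N: module R N by (rule N)
  let ?T = "carrier M \<times> carrier N"
  have d: "u - v \<in> carrier (free_Abelian_group ?T)"
    if "u \<in> carrier (free_Abelian_group ?T)" "v \<in> carrier (free_Abelian_group ?T)"
    for u v :: "'a \<times> 'b \<Rightarrow>\<^sub>0 int"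
    using keys_diff[of u v] that by auto
  show ?thesis
    unfolding tensor_relations_def
    by (intro Un_least subsetI; elim CollectE exE conjE; hypsubst; intro d)
      (simp_all only: frag_of_in_free_Abelian_group mem_Times_iff fst_conv snd_conv
        M.add.m_closed N.add.m_closed M.smult_closed N.smult_closed simp_thms)
qed

lemma tensor_kernel_subgroup:
  "subgroup (tensor_kernel R M N) (free_Abelian_group (carrier M \<times> carrier N))"
  unfolding tensor_kernel_def
  by (rule group.generate_is_subgroup[OF group_free_Abelian_group tensor_relations_subset])

lemma tensor_kernel_keys: "u \<in> tensor_kernel R M N \<Longrightarrow> Poly_Mapping.keys u \<subseteq> carrier M \<times> carrier N"
  using subgroup.mem_carrier[OF tensor_kernel_subgroup] by simp

lemma tensor_kernel_zero: "0 \<in> tensor_kernel R M N"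
  using subgroup.one_closed[OF tensor_kernel_subgroup] by simp

lemma tensor_kernel_add:
  "u \<in> tensor_kernel R M N \<Longrightarrow> v \<in> tensor_kernel R M N \<Longrightarrow> u + v \<in> tensor_kernel R M N"
  using subgroup.m_closed[OF tensor_kernel_subgroup] by simp

lemma tensor_kernel_diff:
  "u \<in> tensor_kernel R M N \<Longrightarrow> v \<in> tensor_kernel R M N \<Longrightarrow> u - v \<in> tensor_kernel R M N"
  using tensor_kernel_add[of u "- v"] subgroup.m_inv_closed[OF tensor_kernel_subgroup, of v]
    inv_free_Abelian_group[OF tensor_kernel_keys, of v] by simp

lemma tensor_kernel_add_left:
  "x \<in> carrier M \<Longrightarrow> x' \<in> carrier M \<Longrightarrow> y \<in> carrier N \<Longrightarrow>
    frag_of (x \<oplus>\<^bsub>M\<^esub> x', y) - frag_of (x, y) - frag_of (x', y) \<in> tensor_kernel R M N"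
  unfolding tensor_kernel_def by (intro generate.incl) (auto simp: tensor_relations_def)

lemma tensor_kernel_add_right:
  "x \<in> carrier M \<Longrightarrow> y \<in> carrier N \<Longrightarrow> y' \<in> carrier N \<Longrightarrow>
    frag_of (x, y \<oplus>\<^bsub>N\<^esub> y') - frag_of (x, y) - frag_of (x, y') \<in> tensor_kernel R M N"
  unfolding tensor_kernel_def by (intro generate.incl) (auto simp: tensor_relations_def)

lemma tensor_kernel_smult:
  "r \<in> carrier R \<Longrightarrow> x \<in> carrier M \<Longrightarrow> y \<in> carrier N \<Longrightarrow>
    frag_of (r \<odot>\<^bsub>M\<^esub> x, y) - frag_of (x, r \<odot>\<^bsub>N\<^esub> y) \<in> tensor_kernel R M N"
  unfolding tensor_kernel_def by (intro generate.incl) (auto simp: tensor_relations_def)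

lemma tensor_kernel_zero_left:
  assumes "y \<in> carrier N"
  shows "frag_of (\<zero>\<^bsub>M\<^esub>, y) \<in> tensor_kernel R M N"
proof -
  interpret M: module R M by (rule M)
  have "0 - (frag_of (\<zero>\<^bsub>M\<^esub> \<oplus>\<^bsub>M\<^esub> \<zero>\<^bsub>M\<^esub>, y) - frag_of (\<zero>\<^bsub>M\<^esub>, y) - frag_of (\<zero>\<^bsub>M\<^esub>, y)) \<in> tensor_kernel R M N"
    by (intro tensor_kernel_diff tensor_kernel_zero tensor_kernel_add_left assms M.zero_closed)
  then show ?thesis by simp
qed

lemma tensor_kernel_subsetI:
  assumes "subgroup H (free_Abelian_group (carrier M \<times> carrier N))"
    and "\<And>x x' y. x \<in> carrier M \<Longrightarrow> x' \<in> carrier M \<Longrightarrow> y \<in> carrier N \<Longrightarrow>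
      frag_of (x \<oplus>\<^bsub>M\<^esub> x', y) - frag_of (x, y) - frag_of (x', y) \<in> H"
    and "\<And>x y y'. x \<in> carrier M \<Longrightarrow> y \<in> carrier N \<Longrightarrow> y' \<in> carrier N \<Longrightarrow>
      frag_of (x, y \<oplus>\<^bsub>N\<^esub> y') - frag_of (x, y) - frag_of (x, y') \<in> H"
    and "\<And>r x y. r \<in> carrier R \<Longrightarrow> x \<in> carrier M \<Longrightarrow> y \<in> carrier N \<Longrightarrow>
      frag_of (r \<odot>\<^bsub>M\<^esub> x, y) - frag_of (x, r \<odot>\<^bsub>N\<^esub> y) \<in> H"
  shows "tensor_kernel R M N \<subseteq> H"
  unfolding tensor_kernel_def
  by (rule group.generate_subgroup_incl[OF group_free_Abelian_group _ assms(1)])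
    (use assms(2-4) in \<open>auto simp: tensor_relations_def\<close>)

end

text \<open>The lift of \<open>f \<otimes> id\<close> to the free abelian groups.\<close>

abbreviation free_tensor_map :: "('a \<Rightarrow> 'p) \<Rightarrow> ('a \<times> 'b \<Rightarrow>\<^sub>0 int) \<Rightarrow> ('p \<times> 'b \<Rightarrow>\<^sub>0 int)" where
  "free_tensor_map f \<equiv> frag_extend (\<lambda>(x, y). frag_of (f x, y))"

lemma free_tensor_map_kernel:
  assumes M: "module R M" and P: "module R P" and N: "module R N" and f: "f \<in> module_homs R M P"
    and u: "u \<in> tensor_kernel R M N"
  shows "free_tensor_map f u \<in> tensor_kernel R P N"
proof -
  interpret M: module R M by (rule M)
  interpret N: module R N by (rule N)
  let ?G = "free_Abelian_group (carrier M \<times> carrier N)"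
  let ?H = "{u \<in> carrier ?G. free_tensor_map f u \<in> tensor_kernel R P N}"
  have fc: "f x \<in> carrier P" if "x \<in> carrier M" for x
    using f that by (auto simp: module_homs_def)
  have "tensor_kernel R M N \<subseteq> ?H"
  proof (rule tensor_kernel_subsetI[OF M N])
    show "subgroup ?H ?G"
    proof (rule group.subgroupI[OF group_free_Abelian_group])
      show "?H \<noteq> {}"
        using tensor_kernel_zero[OF P N] by (auto intro!: exI[of _ 0])
    next
      fix a assume "a \<in> ?H"
      then show "inv\<^bsub>?G\<^esub> a \<in> ?H"
        using tensor_kernel_diff[OF P N tensor_kernel_zero[OF P N]]
        by (auto simp: frag_extend_minus)
    next
      fix a b assume "a \<in> ?H" "b \<in> ?H"
      then show "a \<otimes>\<^bsub>?G\<^esub> b \<in> ?H"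
        using keys_add[of a b] tensor_kernel_add[OF P N] by (auto simp: frag_extend_add)
    qed auto
    have k: "u \<in> carrier ?G" if "u \<in> tensor_kernel R M N" for u
      using tensor_kernel_keys[OF M N that] by simp
    show "frag_of (x \<oplus>\<^bsub>M\<^esub> x', y) - frag_of (x, y) - frag_of (x', y) \<in> ?H"
      if "x \<in> carrier M" "x' \<in> carrier M" "y \<in> carrier N" for x x' y
      using k[OF tensor_kernel_add_left[OF M N that]] f fc that
        tensor_kernel_add_left[OF P N fc[OF that(1)] fc[OF that(2)] that(3)]
      by (auto simp: frag_extend_diff module_homs_def)
    show "frag_of (x, y \<oplus>\<^bsub>N\<^esub> y') - frag_of (x, y) - frag_of (x, y') \<in> ?H"
      if "x \<in> carrier M" "y \<in> carrier N" "y' \<in> carrier N" for x y y'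
      using k[OF tensor_kernel_add_right[OF M N that]] that
        tensor_kernel_add_right[OF P N fc[OF that(1)] that(2,3)]
      by (auto simp: frag_extend_diff)
    show "frag_of (r \<odot>\<^bsub>M\<^esub> x, y) - frag_of (x, r \<odot>\<^bsub>N\<^esub> y) \<in> ?H"
      if "r \<in> carrier R" "x \<in> carrier M" "y \<in> carrier N" for r x y
      using k[OF tensor_kernel_smult[OF M N that]] f that
        tensor_kernel_smult[OF P N that(1) fc[OF that(2)] that(3)]
      by (auto simp: frag_extend_diff module_homs_def)
  qed
  then show ?thesis using u by auto
qed

text \<open>Injectivity of \<open>f \<otimes> id\<close>, formulated without cosets: an element of the free abelian group that
  becomes zero in \<open>P \<otimes> N\<close> is already zero in \<open>M \<otimes> N\<close>.\<close>

lemma flat_module_tensor_kernel: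
  fixes R :: "('a, 'c) ring_scheme" and N :: "('a, 'b, 'z) module_scheme"
    and M P :: "('a, 'a) module"
  assumes flat: "flat_module R N" and M: "module R M" and P: "module R P"
    and f: "f \<in> module_homs R M P" "inj_on f (carrier M)"
    and u: "u \<in> carrier (free_Abelian_group (carrier M \<times> carrier N))"
    and fu: "free_tensor_map f u \<in> tensor_kernel R P N"
  shows "u \<in> tensor_kernel R M N"
proof -
  let ?G = "free_Abelian_group (carrier M \<times> carrier N)"
  let ?K = "tensor_kernel R M N" and ?L = "tensor_kernel R P N"
  have N: "module R N"
    using flat by (simp add: flat_module_def)
  have coset: "C = tensor_kernel R P N"
    if "C = ?L #>\<^bsub>free_Abelian_group (carrier P \<times> carrier N)\<^esub> v" "v \<in> ?L" for C v
    using that subgroup.rcos_const[OF tensor_kernel_subgroup[OF P N] group_free_Abelian_group] by simp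
  \<comment> \<open>Every element with this property has a coset that is mapped to the zero coset.\<close>
  have map: "tensor_map R P N f (?K #>\<^bsub>?G\<^esub> v) = ?L"
    if v: "free_tensor_map f v \<in> ?L" for v
  proof -
    have "free_tensor_map f w \<in> ?L" if "w \<in> ?K #>\<^bsub>?G\<^esub> v" for w
      using that v free_tensor_map_kernel[OF M P N f(1)] tensor_kernel_add[OF P N]
      by (auto simp: r_coset_def frag_extend_add)
    moreover have "0 + v \<in> ?K #>\<^bsub>?G\<^esub> v"
      using tensor_kernel_zero[OF M N] by (auto simp: r_coset_def)
    ultimately show ?thesis
      unfolding tensor_map_def using coset[OF refl] by blast
  qed
  have inj: "inj_on (tensor_map R P N f) (carrier (tensor_product R M N))"
    using flat M P f by (simp add: flat_module_def)
  have "?K #>\<^bsub>?G\<^esub> u = ?K #>\<^bsub>?G\<^esub> 0"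
  proof (rule inj_onD[OF inj])
    show "tensor_map R P N f (?K #>\<^bsub>?G\<^esub> u) = tensor_map R P N f (?K #>\<^bsub>?G\<^esub> 0)"
      using map[OF fu] map[of 0] tensor_kernel_zero[OF P N] by simp
  qed (use u in \<open>auto simp: tensor_product_def FactGroup_def RCOSETS_def\<close>)
  moreover have "0 + u \<in> ?K #>\<^bsub>?G\<^esub> u"
    using tensor_kernel_zero[OF M N] by (auto simp: r_coset_def)
  ultimately have "u \<in> ?K #>\<^bsub>?G\<^esub> 0"
    by simp
  then show ?thesis
    by (auto simp: r_coset_def)
qed

section \<open>Quotients realised on coset representatives\<close>

text \<open>Flatness is tested on modules whose elements lie in the type of the elements of \<open>R\<close>, whereas
  the elements of a quotient \<open>R/I\<close> are sets.  Quotients are therefore realised on chosen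
  representatives of the cosets.\<close>

definition (in ring) coset_rep :: "'a set \<Rightarrow> 'a \<Rightarrow> 'a" where
  "coset_rep I a = (SOME b. b \<in> I +> a)"

text \<open>The image of \<open>K\<close> in \<open>R/I\<close>, that is \<open>(K + I)/I\<close>; every result of an operation is replaced by
  the representative of its coset.\<close>

definition (in ring) rep_module :: "'a set \<Rightarrow> 'a set \<Rightarrow> ('a, 'a) module" where
  "rep_module I K =
    \<lparr>carrier = coset_rep I ` K, monoid.mult = undefined, monoid.one = undefined,
     ring.zero = coset_rep I \<zero>, ring.add = (\<lambda>a b. coset_rep I (a \<oplus> b)),
     smult = (\<lambda>r a. coset_rep I (r \<otimes> a))\<rparr>"

context cring
begin

lemma coset_rep_mem:
  assumes "ideal I R" "a \<in> carrier R"
  shows "coset_rep I a \<in> carrier R" "coset_rep I a \<ominus> a \<in> I"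
proof -
  interpret I: ideal I R by fact
  have "\<zero> \<oplus> a \<in> I +> a"
    by (auto simp: a_r_coset_def')
  then have "coset_rep I a \<in> I +> a"
    unfolding coset_rep_def by (rule someI)
  then obtain i where "i \<in> I" "coset_rep I a = i \<oplus> a"
    by (auto simp: a_r_coset_def')
  then show "coset_rep I a \<in> carrier R" "coset_rep I a \<ominus> a \<in> I"
    using assms(2) by (auto simp: a_minus_def a_assoc r_neg)
qed

lemma coset_rep_eq_iff:
  assumes "ideal I R" "a \<in> carrier R" "b \<in> carrier R"
  shows "coset_rep I a = coset_rep I b \<longleftrightarrow> a \<ominus> b \<in> I"
proof
  interpret I: ideal I R by fact
  note c = coset_rep_mem[OF assms(1,2)] coset_rep_mem[OF assms(1,3)]
  assume eq: "coset_rep I a = coset_rep I b"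
  have "a \<ominus> b = (coset_rep I b \<ominus> b) \<ominus> (coset_rep I a \<ominus> a)"
    using c assms(2,3) unfolding eq by algebra
  then show "a \<ominus> b \<in> I"
    using c by (simp add: a_minus_def)
next
  assume "a \<ominus> b \<in> I"
  then show "coset_rep I a = coset_rep I b"
    using quotient_eq_iff_same_a_r_cos[OF assms] by (simp add: coset_rep_def)
qed

lemma coset_rep_add:
  assumes I: "ideal I R" and a: "a \<in> carrier R" "b \<in> carrier R"
  shows "coset_rep I (coset_rep I a \<oplus> b) = coset_rep I (a \<oplus> b)"
    "coset_rep I (a \<oplus> coset_rep I b) = coset_rep I (a \<oplus> b)"
proof -
  note c = coset_rep_mem[OF I a(1)] coset_rep_mem[OF I a(2)]
  have "(coset_rep I a \<oplus> b) \<ominus> (a \<oplus> b) = coset_rep I a \<ominus> a"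
    "(a \<oplus> coset_rep I b) \<ominus> (a \<oplus> b) = coset_rep I b \<ominus> b"
    using c a by algebra+
  then show "coset_rep I (coset_rep I a \<oplus> b) = coset_rep I (a \<oplus> b)"
    "coset_rep I (a \<oplus> coset_rep I b) = coset_rep I (a \<oplus> b)"
    using c a by (simp_all add: coset_rep_eq_iff[OF I])
qed

text \<open>Multiplication by \<open>y\<close> is a well-defined map from \<open>R/L\<close> to \<open>R/I\<close>.\<close>

lemma coset_rep_mult:
  assumes I: "ideal I R" and L: "ideal L R" and y: "y \<in> carrier R" "\<And>l. l \<in> L \<Longrightarrow> l \<otimes> y \<in> I"
    and a: "a \<in> carrier R"
  shows "coset_rep I (coset_rep L a \<otimes> y) = coset_rep I (a \<otimes> y)"
proof -
  note c = coset_rep_mem[OF L a]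
  have "(coset_rep L a \<otimes> y) \<ominus> (a \<otimes> y) = (coset_rep L a \<ominus> a) \<otimes> y"
    using c a y(1) by algebra
  then show ?thesis
    using c a y by (simp add: coset_rep_eq_iff[OF I])
qed

lemma coset_rep_lmult:
  assumes I: "ideal I R" and y: "y \<in> carrier R" and a: "a \<in> carrier R"
  shows "coset_rep I (y \<otimes> coset_rep I a) = coset_rep I (y \<otimes> a)"
  using coset_rep_mult[OF I I y _ a] ideal.I_r_closed[OF I _ y] coset_rep_mem[OF I a] a y
  by (simp add: m_comm)

lemma coset_rep_idem:
  assumes "ideal I R" "a \<in> carrier R"
  shows "coset_rep I (coset_rep I a) = coset_rep I a"
  using coset_rep_lmult[OF assms(1) one_closed assms(2)] coset_rep_mem[OF assms] assms(2) by simp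

lemma rep_module_module:
  assumes I: "ideal I R" and K: "ideal K R"
  shows "module R (rep_module I K)"
proof -
  interpret K: ideal K R by fact
  note simps = rep_module_def coset_rep_add[OF I] coset_rep_lmult[OF I] coset_rep_mem[OF I]
  have "abelian_group (rep_module I K)"
  proof (rule abelian_groupI)
    fix x y z
    assume "x \<in> carrier (rep_module I K)" "y \<in> carrier (rep_module I K)" "z \<in> carrier (rep_module I K)"
    then obtain a b c where abc: "a \<in> K" "b \<in> K" "c \<in> K"
      "x = coset_rep I a" "y = coset_rep I b" "z = coset_rep I c"
      by (auto simp: rep_module_def)
    then show "(x \<oplus>\<^bsub>rep_module I K\<^esub> y) \<oplus>\<^bsub>rep_module I K\<^esub> z = x \<oplus>\<^bsub>rep_module I K\<^esub> (y \<oplus>\<^bsub>rep_module I K\<^esub> z)"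
      by (simp add: simps a_assoc)
  next
    fix x y
    assume "x \<in> carrier (rep_module I K)" "y \<in> carrier (rep_module I K)"
    then obtain a b where abc: "a \<in> K" "b \<in> K"
      "x = coset_rep I a" "y = coset_rep I b"
      by (auto simp: rep_module_def)
    then show "x \<oplus>\<^bsub>rep_module I K\<^esub> y = y \<oplus>\<^bsub>rep_module I K\<^esub> x"
      "x \<oplus>\<^bsub>rep_module I K\<^esub> y \<in> carrier (rep_module I K)"
      by (simp_all add: simps a_comm)
  next
    show "\<zero>\<^bsub>rep_module I K\<^esub> \<in> carrier (rep_module I K)"
      by (simp add: simps)
  next
    fix x assume "x \<in> carrier (rep_module I K)"
    then obtain a where a: "a \<in> K" "x = coset_rep I a"
      by (auto simp: rep_module_def)
    then show "\<zero>\<^bsub>rep_module I K\<^esub> \<oplus>\<^bsub>rep_module I K\<^esub> x = x"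
      by (simp add: simps)
    show "\<exists>y\<in>carrier (rep_module I K). y \<oplus>\<^bsub>rep_module I K\<^esub> x = \<zero>\<^bsub>rep_module I K\<^esub>"
      using a by (intro bexI[of _ "coset_rep I (\<ominus> a)"]) (simp_all add: simps l_neg)
  qed
  moreover have "module_axioms R (rep_module I K)"
  proof
    fix r s x y
    assume r: "r \<in> carrier R" and s: "s \<in> carrier R"
      and "x \<in> carrier (rep_module I K)" "y \<in> carrier (rep_module I K)"
    then obtain a b where ab: "a \<in> K" "b \<in> K" "x = coset_rep I a" "y = coset_rep I b"
      by (auto simp: rep_module_def)
    show "r \<odot>\<^bsub>rep_module I K\<^esub> (x \<oplus>\<^bsub>rep_module I K\<^esub> y)
        = r \<odot>\<^bsub>rep_module I K\<^esub> x \<oplus>\<^bsub>rep_module I K\<^esub> r \<odot>\<^bsub>rep_module I K\<^esub> y"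
      using r ab by (simp add: simps r_distr)
  next
    fix r s x
    assume r: "r \<in> carrier R" and s: "s \<in> carrier R"
      and "x \<in> carrier (rep_module I K)"
    then obtain a where ab: "a \<in> K" "x = coset_rep I a"
      by (auto simp: rep_module_def)
    show "(r \<oplus> s) \<odot>\<^bsub>rep_module I K\<^esub> x = r \<odot>\<^bsub>rep_module I K\<^esub> x \<oplus>\<^bsub>rep_module I K\<^esub> s \<odot>\<^bsub>rep_module I K\<^esub> x"
      using r s ab by (simp add: simps) (simp add: l_distr)
    show "(r \<otimes> s) \<odot>\<^bsub>rep_module I K\<^esub> x = r \<odot>\<^bsub>rep_module I K\<^esub> (s \<odot>\<^bsub>rep_module I K\<^esub> x)"
      using r s ab by (simp add: simps) (simp add: m_assoc)
  next
    fix r x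
    assume r: "r \<in> carrier R" and "x \<in> carrier (rep_module I K)"
    then show "r \<odot>\<^bsub>rep_module I K\<^esub> x \<in> carrier (rep_module I K)"
      using K.I_l_closed[OF _ r] by (auto simp: simps)
  next
    fix x
    assume "x \<in> carrier (rep_module I K)"
    then show "\<one> \<odot>\<^bsub>rep_module I K\<^esub> x = x"
      by (auto simp: simps coset_rep_idem[OF I])
  qed
  ultimately show ?thesis
    by (intro module.intro is_cring)
qed

text \<open>Multiplication by \<open>y\<close> induces a map from \<open>K\<close> to \<open>R/I\<close> with kernel \<open>L\<close>, hence an
  injection of \<open>K/L\<close> into \<open>R/I\<close>.  This is the injection on which flatness will be tested.\<close>

lemma rep_module_mult_hom:
  assumes I: "ideal I R" and K: "ideal K R" and y: "y \<in> carrier R"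
  defines "L \<equiv> {a \<in> K. a \<otimes> y \<in> I}"
  defines "f \<equiv> \<lambda>m. coset_rep I (m \<otimes> y)"
  shows "ideal L R"
    and "\<And>a. a \<in> carrier R \<Longrightarrow> f (coset_rep L a) = coset_rep I (a \<otimes> y)"
    and "f \<in> module_homs R (rep_module L K) (rep_module I (carrier R))"
    and "inj_on f (carrier (rep_module L K))"
proof -
  interpret K: ideal K R by fact
  have "L = K \<inter> colon R I {y}"
    by (auto simp: L_def colon_def)
  then show L: "ideal L R"
    using i_intersect[OF K colon_ideal[OF I]] y by simp
  show f: "f (coset_rep L a) = coset_rep I (a \<otimes> y)" if "a \<in> carrier R" for a
    unfolding f_def by (rule coset_rep_mult[OF I L y _ that]) (simp add: L_def)
  show "f \<in> module_homs R (rep_module L K) (rep_module I (carrier R))"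
    unfolding module_homs_def
    by (auto simp: rep_module_def coset_rep_mem[OF L] coset_rep_mem[OF I] coset_rep_add[OF L] coset_rep_add[OF I]
      coset_rep_lmult[OF L] coset_rep_lmult[OF I] f y l_distr m_assoc)
  show "inj_on f (carrier (rep_module L K))"
  proof (rule inj_onI)
    fix m n assume "m \<in> carrier (rep_module L K)" "n \<in> carrier (rep_module L K)" and eq: "f m = f n"
    then obtain a b where ab: "a \<in> K" "b \<in> K" "m = coset_rep L a" "n = coset_rep L b"
      by (auto simp: rep_module_def)
    then have ab': "a \<in> carrier R" "b \<in> carrier R"
      by auto
    then have "(a \<otimes> y) \<ominus> (b \<otimes> y) \<in> I"
      using eq y by (simp add: ab f coset_rep_eq_iff[OF I])
    moreover have "(a \<otimes> y) \<ominus> (b \<otimes> y) = (a \<ominus> b) \<otimes> y"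
      using ab' y by algebra
    ultimately have "a \<ominus> b \<in> L"
      using ab by (simp add: L_def a_minus_def)
    then show "m = n"
      using ab ab' by (simp add: coset_rep_eq_iff[OF L])
  qed
qed

end

section \<open>Colon ideals and flat extensions\<close>

context ring_hom_cring
begin

text \<open>Every element of \<open>IS\<close> is a sum of elements \<open>a s\<close> with \<open>a \<in> I\<close>.  Instead of handling sums, the
  proof observes that the elements all of whose multiples satisfy \<open>P\<close> form an ideal; taking all
  multiples is what makes this set closed under negation.\<close>

lemma ext_induct [consumes 2, case_names mult add]:
  assumes I: "ideal I R" and x: "x \<in> ext I"
    and mult: "\<And>a s. a \<in> I \<Longrightarrow> s \<in> carrier S \<Longrightarrow> P (h a \<otimes>\<^bsub>S\<^esub> s)"
    and add: "\<And>x y. x \<in> carrier S \<Longrightarrow> y \<in> carrier S \<Longrightarrow> P x \<Longrightarrow> P y \<Longrightarrow> P (x \<oplus>\<^bsub>S\<^esub> y)"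
  shows "P x"
proof -
  have I': "I \<subseteq> carrier R"
    by (rule R.ideal_subset_carrier[OF I])
  let ?E = "{x \<in> carrier S. \<forall>s\<in>carrier S. P (x \<otimes>\<^bsub>S\<^esub> s)}"
  have E: "ideal ?E S"
  proof (rule idealI[OF S.ring_axioms])
    show "subgroup ?E (add_monoid S)"
    proof (rule group.subgroupI[OF S.a_group])
      have "P (\<zero>\<^bsub>S\<^esub> \<otimes>\<^bsub>S\<^esub> s)" if "s \<in> carrier S" for s
        using mult[of \<zero> s] R.ideal_zero_mem[OF I] that by simp
      then show "?E \<noteq> {}"
        by blast
      show "inv\<^bsub>add_monoid S\<^esub> a \<in> ?E" if "a \<in> ?E" for a
        using that S.a_inv_closed unfolding a_inv_def[symmetric]
        by (auto simp: S.l_minus simp flip: S.r_minus)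
    qed (auto simp: S.l_distr add)
  qed (auto simp: S.m_assoc S.m_comm S.m_lcomm)
  have "h ` I \<subseteq> ?E"
    using I' mult by auto
  then have "x \<in> ?E"
    using S.genideal_minimal[OF E] x by blast
  then have "P (x \<otimes>\<^bsub>S\<^esub> \<one>\<^bsub>S\<^esub>)"
    by blast
  then show ?thesis
    using \<open>x \<in> ?E\<close> by simp
qed

lemma scalar_module_simps:
  "carrier (scalar_module h S) = carrier S"
  "x \<oplus>\<^bsub>scalar_module h S\<^esub> y = x \<oplus>\<^bsub>S\<^esub> y"
  "r \<odot>\<^bsub>scalar_module h S\<^esub> x = h r \<otimes>\<^bsub>S\<^esub> x"
  by (simp_all add: scalar_module_def)

text \<open>The map \<open>K/L \<otimes> S \<rightarrow> S/LS\<close> sending \<open>a \<otimes> s\<close> to the class of \<open>a s\<close>, in the form of a map \<open>e\<close>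
  from the free abelian group to \<open>S\<close> that sends the tensor relations into \<open>LS\<close>.  The relations
  need not be sent to zero, since on representatives the operations of \<open>K/L\<close> agree with those of
  \<open>R\<close> only modulo \<open>L\<close>.\<close>

lemma coset_tensor_eval:
  assumes N: "module R (scalar_module h S)" and K: "ideal K R" and L: "ideal L R"
  defines "M \<equiv> R.rep_module L K"
  defines "G \<equiv> free_Abelian_group (carrier M \<times> carrier S)"
  obtains e where "e \<in> hom G (add_monoid S)"
    and "\<And>m s. m \<in> carrier M \<Longrightarrow> s \<in> carrier S \<Longrightarrow> e (frag_of (m, s)) = h m \<otimes>\<^bsub>S\<^esub> s"
    and "\<And>u. u \<in> tensor_kernel R M (scalar_module h S) \<Longrightarrow> e u \<in> ext L"
proof -
  have M: "module R M"
    unfolding M_def by (rule R.rep_module_module[OF L K])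
  have Kc: "K \<subseteq> carrier R" and Lc: "L \<subseteq> carrier R"
    by (intro R.ideal_subset_carrier K L)+
  have Mc: "carrier M \<subseteq> carrier R"
    unfolding M_def using Kc R.coset_rep_mem[OF L] by (auto simp: R.rep_module_def)
  interpret eL: ideal "ext L" S
    by (rule ext_ideal[OF Lc])
  obtain e where e: "e \<in> hom G (add_monoid S)"
    and eval: "\<And>p. p \<in> carrier M \<times> carrier S \<Longrightarrow> e (frag_of p) = (\<lambda>(m, s). h m \<otimes>\<^bsub>S\<^esub> s) p"
  proof (rule comm_group.free_Abelian_group_universal[OF S.a_comm_group])
    show "(\<lambda>(m, s). h m \<otimes>\<^bsub>S\<^esub> s) ` (carrier M \<times> carrier S) \<subseteq> carrier (add_monoid S)"
      using Mc by auto
  qed (use that in \<open>auto simp: G_def\<close>)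
  interpret e: group_hom G "add_monoid S" e
    using e S.a_group by (simp add: group_hom_def group_hom_axioms_def G_def)
  have inv: "e (- u) = \<ominus>\<^bsub>S\<^esub> e u" if "u \<in> carrier G" for u
    using e.hom_inv[OF that] that unfolding a_inv_def[symmetric] by (simp add: G_def)
  have diff: "e (u - v) = e u \<ominus>\<^bsub>S\<^esub> e v" if "u \<in> carrier G" "v \<in> carrier G" for u v
    using e.hom_mult[OF that(1), of "- v"] inv[OF that(2)] that by (simp add: G_def a_minus_def)
  have dc: "u - v \<in> carrier G" if "u \<in> carrier G" "v \<in> carrier G" for u v
    using keys_diff[of u v] that by (auto simp: G_def)
  have ev: "e (frag_of (m, s)) = h m \<otimes>\<^bsub>S\<^esub> s" if "m \<in> carrier M" "s \<in> carrier S" for m s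
    using eval that by simp
  have fr: "frag_of (m, s) \<in> carrier G" if "m \<in> carrier M" "s \<in> carrier S" for m s
    using that by (simp add: G_def)
  let ?H = "{u \<in> carrier G. e u \<in> ext L}"
  have mem: "h a \<otimes>\<^bsub>S\<^esub> s \<in> ext L" if "a \<in> L" "s \<in> carrier S" for a s
    using mem_ext[OF Lc that(1)] that(2) by (rule eL.I_r_closed)
  interpret M: module R M by (rule M)
  have "tensor_kernel R M (scalar_module h S) \<subseteq> ?H"
  proof (rule tensor_kernel_subsetI[OF M N], unfold scalar_module_simps)
    have "subgroup ?H G"
    proof (rule group.subgroupI)
      show "group G" by (simp add: G_def)
      show "?H \<noteq> {}"
        using e.hom_one e.one_closed eL.zero_closed by (auto intro!: exI[of _ "\<one>\<^bsub>G\<^esub>"])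
      show "inv\<^bsub>G\<^esub> a \<in> ?H" if "a \<in> ?H" for a
        using that inv[of a] by (auto simp: G_def)
      show "a \<otimes>\<^bsub>G\<^esub> b \<in> ?H" if "a \<in> ?H" "b \<in> ?H" for a b
        using that e.hom_mult[of a b] e.m_closed[of a b] by auto
    qed auto
    then show "subgroup ?H (free_Abelian_group (carrier M \<times> carrier S))"
      by (simp add: G_def)
  next
    fix m m' s assume m: "m \<in> carrier M" "m' \<in> carrier M" and s: "s \<in> carrier S"
    have mm: "m \<in> carrier R" "m' \<in> carrier R"
      using m Mc by auto
    have eq: "m \<oplus>\<^bsub>M\<^esub> m' = R.coset_rep L (m \<oplus> m')"
      by (simp add: M_def R.rep_module_def)
    have c: "m \<oplus>\<^bsub>M\<^esub> m' \<in> carrier R" "(m \<oplus>\<^bsub>M\<^esub> m') \<ominus> (m \<oplus> m') \<in> L"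
      unfolding eq using R.coset_rep_mem[OF L] mm by auto
    have "h (m \<oplus>\<^bsub>M\<^esub> m') \<otimes>\<^bsub>S\<^esub> s \<ominus>\<^bsub>S\<^esub> h m \<otimes>\<^bsub>S\<^esub> s \<ominus>\<^bsub>S\<^esub> h m' \<otimes>\<^bsub>S\<^esub> s
        = h ((m \<oplus>\<^bsub>M\<^esub> m') \<ominus> (m \<oplus> m')) \<otimes>\<^bsub>S\<^esub> s"
      using c(1) mm s by (simp add: a_minus_def S.l_distr S.l_minus S.minus_add S.a_assoc)
    then show "frag_of (m \<oplus>\<^bsub>M\<^esub> m', s) - frag_of (m, s) - frag_of (m', s) \<in> ?H"
      using mem[OF c(2) s] m s by (simp add: dc fr diff ev)
  next
    fix m s s' assume m: "m \<in> carrier M" and s: "s \<in> carrier S" "s' \<in> carrier S"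
    have "h m \<in> carrier S"
      using m Mc by auto
    then have "h m \<otimes>\<^bsub>S\<^esub> (s \<oplus>\<^bsub>S\<^esub> s') \<ominus>\<^bsub>S\<^esub> h m \<otimes>\<^bsub>S\<^esub> s \<ominus>\<^bsub>S\<^esub> h m \<otimes>\<^bsub>S\<^esub> s' = \<zero>\<^bsub>S\<^esub>"
      using s by algebra
    then show "frag_of (m, s \<oplus>\<^bsub>S\<^esub> s') - frag_of (m, s) - frag_of (m, s') \<in> ?H"
      using m s by (simp add: dc fr diff ev)
  next
    fix r m s assume r: "r \<in> carrier R" and m: "m \<in> carrier M" and s: "s \<in> carrier S"
    have mm: "m \<in> carrier R"
      using m Mc by auto
    have eq: "r \<odot>\<^bsub>M\<^esub> m = R.coset_rep L (r \<otimes> m)"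
      by (simp add: M_def R.rep_module_def)
    have c: "r \<odot>\<^bsub>M\<^esub> m \<in> carrier R" "(r \<odot>\<^bsub>M\<^esub> m) \<ominus> (r \<otimes> m) \<in> L"
      unfolding eq using R.coset_rep_mem[OF L] mm r by auto
    have "h (r \<odot>\<^bsub>M\<^esub> m) \<otimes>\<^bsub>S\<^esub> s \<ominus>\<^bsub>S\<^esub> h m \<otimes>\<^bsub>S\<^esub> (h r \<otimes>\<^bsub>S\<^esub> s)
        = h ((r \<odot>\<^bsub>M\<^esub> m) \<ominus> (r \<otimes> m)) \<otimes>\<^bsub>S\<^esub> s"
      using c(1) mm s r
      by (simp add: a_minus_def S.l_distr S.l_minus S.m_assoc S.m_lcomm[of "h m" "h r"])
    then show "frag_of (r \<odot>\<^bsub>M\<^esub> m, s) - frag_of (m, h r \<otimes>\<^bsub>S\<^esub> s) \<in> ?H"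
      using mem[OF c(2) s] m s r by (simp add: dc fr diff ev)
  qed
  then show ?thesis
    using that[of e] e ev by blast
qed

text \<open>In \<open>R/I \<otimes> S\<close> one has \<open>1 \<otimes> a s = a \<otimes> s = 0\<close> for \<open>a \<in> I\<close>.\<close>

lemma cyclic_tensor_kernel:
  assumes N: "module R (scalar_module h S)" and I: "ideal I R"
    and x: "x \<in> ext I"
  defines "P \<equiv> R.rep_module I (carrier R)"
  shows "frag_of (R.coset_rep I \<one>, x) \<in> tensor_kernel R P (scalar_module h S)" (is "_ \<in> ?K")
  using I x
proof (induction rule: ext_induct)
  case (mult a s)
  have P: "module R P"
    unfolding P_def by (rule R.rep_module_module[OF I R.oneideal])
  have p1: "R.coset_rep I \<one> \<in> carrier P"
    by (simp add: P_def R.rep_module_def)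
  have a: "a \<in> carrier R"
    using mult(1) ideal.Icarr[OF I] by blast
  have "R.coset_rep I a = R.coset_rep I \<zero>"
    using R.coset_rep_eq_iff[OF I, of a \<zero>] mult(1) a by (simp add: a_minus_def)
  then have "a \<odot>\<^bsub>P\<^esub> R.coset_rep I \<one> = \<zero>\<^bsub>P\<^esub>"
    using a by (simp add: P_def R.rep_module_def R.coset_rep_lmult[OF I])
  then have "frag_of (\<zero>\<^bsub>P\<^esub>, s) - frag_of (R.coset_rep I \<one>, h a \<otimes>\<^bsub>S\<^esub> s) \<in> ?K"
    using tensor_kernel_smult[OF P N a p1, of s] mult(2) by (simp add: scalar_module_simps)
  moreover have "frag_of (\<zero>\<^bsub>P\<^esub>, s) \<in> ?K"
    using tensor_kernel_zero_left[OF P N, of s] mult(2) by (simp add: scalar_module_simps)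
  ultimately have "frag_of (\<zero>\<^bsub>P\<^esub>, s) - (frag_of (\<zero>\<^bsub>P\<^esub>, s) - frag_of (R.coset_rep I \<one>, h a \<otimes>\<^bsub>S\<^esub> s)) \<in> ?K"
    by (rule tensor_kernel_diff[OF P N, rotated])
  then show ?case by simp
next
  case (add x y)
  have P: "module R P"
    unfolding P_def by (rule R.rep_module_module[OF I R.oneideal])
  have p1: "R.coset_rep I \<one> \<in> carrier P"
    by (simp add: P_def R.rep_module_def)
  let ?p = "R.coset_rep I \<one>"
  have "(frag_of (?p, x \<oplus>\<^bsub>S\<^esub> y) - frag_of (?p, x) - frag_of (?p, y)) + frag_of (?p, x) + frag_of (?p, y) \<in> ?K"
    using tensor_kernel_add_right[OF P N p1, of x y] add
    by (intro tensor_kernel_add[OF P N]) (simp_all add: scalar_module_simps)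
  then show ?case by simp
qed

text \<open>This is where flatness enters.  Let \<open>L = {a \<in> K. a y \<in> I}\<close> and write \<open>x = \<Sum> a_i s_i\<close> with \<open>a_i \<in> K\<close>.
  The injection of \<open>K/L\<close> into \<open>R/I\<close> given by multiplication with \<open>y\<close> maps \<open>\<Sum> a_i \<otimes> s_i\<close> to
  \<open>1 \<otimes> y x\<close>, which vanishes because \<open>y x \<in> IS\<close>.  By flatness \<open>\<Sum> a_i \<otimes> s_i = 0\<close> in \<open>K/L \<otimes> S\<close>, and
  evaluation in \<open>S/LS\<close> gives \<open>x \<in> LS\<close>.\<close>

lemma flat_ext_mem:
  assumes flat: "flat_hom R S h"
    and I: "ideal I R" and K: "ideal K R" and y: "y \<in> carrier R"
    and x: "x \<in> ext K" and xy: "h y \<otimes>\<^bsub>S\<^esub> x \<in> ext I"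
  shows "x \<in> ext {a \<in> K. a \<otimes> y \<in> I}"
proof -
  define L where "L = {a \<in> K. a \<otimes> y \<in> I}"
  define f where "f m = R.coset_rep I (m \<otimes> y)" for m
  let ?N = "scalar_module h S"
  define M where "M = R.rep_module L K"
  define P where "P = R.rep_module I (carrier R)"
  let ?G = "free_Abelian_group (carrier M \<times> carrier S)"
  let ?p = "R.coset_rep I \<one>"
  note hom = R.rep_module_mult_hom[OF I K y, folded L_def f_def, folded M_def P_def]
  have L: "ideal L R" by (rule hom)
  have Kc: "K \<subseteq> carrier R" and Lc: "L \<subseteq> carrier R"
    by (intro R.ideal_subset_carrier K L)+
  have N: "module R ?N"
    using flat by (simp add: flat_hom_def flat_module_def)
  have M: "module R M"
    unfolding M_def by (rule R.rep_module_module[OF L K])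
  have P: "module R P"
    unfolding P_def by (rule R.rep_module_module[OF I R.oneideal])
  have p1: "?p \<in> carrier P"
    by (simp add: P_def R.rep_module_def)
  interpret eL: ideal "ext L" S
    by (rule ext_ideal[OF Lc])
  obtain e where e: "e \<in> hom ?G (add_monoid S)"
    and ev: "\<And>m s. m \<in> carrier M \<Longrightarrow> s \<in> carrier S \<Longrightarrow> e (frag_of (m, s)) = h m \<otimes>\<^bsub>S\<^esub> s"
    and eker: "\<And>u. u \<in> tensor_kernel R M ?N \<Longrightarrow> e u \<in> ext L"
    using coset_tensor_eval[OF N K L] unfolding M_def by blast
  \<comment> \<open>\<open>u\<close> is a formal expression \<open>\<Sum> a_i \<otimes> s_i\<close> for \<open>x\<close>; its values are controlled only modulo
    \<open>LS\<close> and the tensor relations, because the \<open>a_i\<close> are replaced by representatives.\<close>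
  have "\<exists>u\<in>carrier ?G. e u \<ominus>\<^bsub>S\<^esub> x \<in> ext L \<and>
      free_tensor_map f u - frag_of (?p, h y \<otimes>\<^bsub>S\<^esub> x) \<in> tensor_kernel R P ?N"
    using K x
  proof (induction rule: ext_induct)
    case (mult a s)
    have a: "a \<in> carrier R"
      using mult(1) Kc by blast
    let ?m = "R.coset_rep L a"
    have m: "?m \<in> carrier M" "?m \<in> carrier R" "?m \<ominus> a \<in> L"
      using mult(1) R.coset_rep_mem[OF L a] by (auto simp: M_def R.rep_module_def)
    have "e (frag_of (?m, s)) \<ominus>\<^bsub>S\<^esub> h a \<otimes>\<^bsub>S\<^esub> s = h (?m \<ominus> a) \<otimes>\<^bsub>S\<^esub> s"
      using m a mult(2) by (simp add: ev a_minus_def S.l_distr S.l_minus)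
    also have "\<dots> \<in> ext L"
      by (intro eL.I_r_closed mem_ext Lc m mult(2))
    finally have 1: "e (frag_of (?m, s)) \<ominus>\<^bsub>S\<^esub> h a \<otimes>\<^bsub>S\<^esub> s \<in> ext L" .
    have "(a \<otimes> y) \<odot>\<^bsub>P\<^esub> ?p = f ?m"
      using a y by (simp add: hom(2)) (simp add: P_def R.rep_module_def R.coset_rep_lmult[OF I] f_def)
    then have "frag_of (f ?m, s) - frag_of (?p, h (a \<otimes> y) \<otimes>\<^bsub>S\<^esub> s) \<in> tensor_kernel R P ?N"
      using tensor_kernel_smult[OF P N _ p1, of "a \<otimes> y" s] a y mult(2)
      by (simp add: scalar_module_simps del: hom_mult)
    moreover have "h (a \<otimes> y) \<otimes>\<^bsub>S\<^esub> s = h y \<otimes>\<^bsub>S\<^esub> (h a \<otimes>\<^bsub>S\<^esub> s)"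
      using a y mult(2) by (simp add: S.m_ac)
    ultimately show ?case
      using 1 m mult(2) by (intro bexI[of _ "frag_of (?m, s)"]) auto
  next
    case (add x x')
    then obtain u u' where u: "u \<in> carrier ?G" "u' \<in> carrier ?G"
      "e u \<ominus>\<^bsub>S\<^esub> x \<in> ext L" "e u' \<ominus>\<^bsub>S\<^esub> x' \<in> ext L"
      "free_tensor_map f u - frag_of (?p, h y \<otimes>\<^bsub>S\<^esub> x) \<in> tensor_kernel R P ?N"
      "free_tensor_map f u' - frag_of (?p, h y \<otimes>\<^bsub>S\<^esub> x') \<in> tensor_kernel R P ?N"
      by blast
    have uu: "u + u' \<in> carrier ?G"
      using u keys_add[of u u'] by auto
    have ec: "e u \<in> carrier S" "e u' \<in> carrier S" "e (u + u') = e u \<oplus>\<^bsub>S\<^esub> e u'"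
      using hom_in_carrier[OF e] u Group.hom_mult[OF e, of u u'] by auto
    have "e (u + u') \<ominus>\<^bsub>S\<^esub> (x \<oplus>\<^bsub>S\<^esub> x') = (e u \<ominus>\<^bsub>S\<^esub> x) \<oplus>\<^bsub>S\<^esub> (e u' \<ominus>\<^bsub>S\<^esub> x')"
      using ec(1,2) add(1,2) unfolding ec(3) by algebra
    then have 1: "e (u + u') \<ominus>\<^bsub>S\<^esub> (x \<oplus>\<^bsub>S\<^esub> x') \<in> ext L"
      using u by simp
    let ?t = "h y \<otimes>\<^bsub>S\<^esub> x" and ?t' = "h y \<otimes>\<^bsub>S\<^esub> x'"
    have "frag_of (?p, ?t \<oplus>\<^bsub>S\<^esub> ?t') - frag_of (?p, ?t) - frag_of (?p, ?t') \<in> tensor_kernel R P ?N"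
      using tensor_kernel_add_right[OF P N p1, of ?t ?t'] add(1,2) y
      by (simp add: scalar_module_simps)
    then have "(free_tensor_map f u - frag_of (?p, ?t)) + (free_tensor_map f u' - frag_of (?p, ?t'))
        - (frag_of (?p, ?t \<oplus>\<^bsub>S\<^esub> ?t') - frag_of (?p, ?t) - frag_of (?p, ?t')) \<in> tensor_kernel R P ?N"
      by (rule tensor_kernel_diff[OF P N tensor_kernel_add[OF P N u(5,6)]])
    moreover have "?t \<oplus>\<^bsub>S\<^esub> ?t' = h y \<otimes>\<^bsub>S\<^esub> (x \<oplus>\<^bsub>S\<^esub> x')"
      using add(1,2) y by (simp add: S.r_distr)
    ultimately have "free_tensor_map f (u + u') - frag_of (?p, h y \<otimes>\<^bsub>S\<^esub> (x \<oplus>\<^bsub>S\<^esub> x')) \<in> tensor_kernel R P ?N"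
      by (simp add: frag_extend_add algebra_simps)
    then show ?case
      using 1 uu by blast
  qed
  then obtain u where u: "u \<in> carrier ?G" "e u \<ominus>\<^bsub>S\<^esub> x \<in> ext L"
    "free_tensor_map f u - frag_of (?p, h y \<otimes>\<^bsub>S\<^esub> x) \<in> tensor_kernel R P ?N"
    by blast
  have "free_tensor_map f u \<in> tensor_kernel R P ?N"
    using tensor_kernel_add[OF P N u(3)] cyclic_tensor_kernel[OF N I xy] by (fastforce simp: P_def)
  then have "u \<in> tensor_kernel R M ?N"
  proof (rule flat_module_tensor_kernel[OF _ M P hom(3,4), rotated 2])
    show "flat_module R ?N"
      using flat by (simp add: flat_hom_def)
    show "u \<in> carrier (free_Abelian_group (carrier M \<times> carrier ?N))"
      using u(1) by (simp add: scalar_module_simps)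
  qed
  then have eu: "e u \<in> ext L"
    by (rule eker)
  have xc: "x \<in> carrier S"
    using ideal.Icarr[OF ext_ideal[OF Kc] x] .
  have "x = e u \<ominus>\<^bsub>S\<^esub> (e u \<ominus>\<^bsub>S\<^esub> x)"
    using xc eL.Icarr[OF eu] by algebra
  also have "\<dots> \<in> ext L"
    using eu u(2) by (simp add: a_minus_def)
  finally show ?thesis
    by (simp add: L_def)
qed

text \<open>Adding a generator \<open>y\<close> cuts \<open>I : A\<close> down to \<open>(I : A) \<inter> (I : y)\<close>, which is the ideal produced
  by the preceding lemma for \<open>K = I : A\<close>.\<close>

lemma flat_colon_finite:
  assumes flat: "flat_hom R S h" and I: "ideal I R"
    and A: "finite A" "A \<subseteq> carrier R"
    and x: "x \<in> carrier S" "\<And>y. y \<in> A \<Longrightarrow> h y \<otimes>\<^bsub>S\<^esub> x \<in> ext I"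
  shows "x \<in> ext (colon R I A)"
  using A x(2)
proof (induction A rule: finite_induct)
  case empty
  have "colon R I {} = carrier R"
    by (auto simp: colon_def)
  then show ?case
    using x(1) by (simp add: ext_carrier)
next
  case (insert y A)
  have "ideal (colon R I A) R"
    using insert.prems by (intro R.colon_ideal I) auto
  then have "x \<in> ext {a \<in> colon R I A. a \<otimes> y \<in> I}"
    using insert by (intro flat_ext_mem[OF flat I]) auto
  also have "{a \<in> colon R I A. a \<otimes> y \<in> I} = colon R I (insert y A)"
    by (auto simp: colon_def)
  finally show ?case .
qed

theorem flat_ext_colon:
  assumes flat: "flat_hom R S h" and noeth: "noetherian_ring R"
    and I: "ideal I R" and J: "ideal J R"
  shows "ext (colon R I J) = colon S (ext I) (ext J)"
proof
  have Jc: "J \<subseteq> carrier R"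
    by (rule R.ideal_subset_carrier[OF J])
  show "ext (colon R I J) \<subseteq> colon S (ext I) (ext J)"
    by (rule ext_colon_subset[OF I Jc])
  obtain A where A: "A \<subseteq> carrier R" "finite A" "J = Idl A"
    using noetherian_ring.finetely_gen[OF noeth J] by blast
  show "colon S (ext I) (ext J) \<subseteq> ext (colon R I J)"
  proof
    fix x assume "x \<in> colon S (ext I) (ext J)"
    then have x: "x \<in> carrier S" "\<And>y. y \<in> J \<Longrightarrow> x \<otimes>\<^bsub>S\<^esub> h y \<in> ext I"
      by (auto simp: colon_ext[OF I Jc])
    have "h y \<otimes>\<^bsub>S\<^esub> x \<in> ext I" if "y \<in> A" for y
      using x(2)[of y] R.genideal_self[OF A(1)] A that x(1) by (auto simp: S.m_comm subset_iff)
    then have "x \<in> ext (colon R I A)"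
      by (rule flat_colon_finite[OF flat I A(2,1) x(1)])
    then show "x \<in> ext (colon R I J)"
      using R.colon_genideal[OF I A(1)] A(3) by simp
  qed
qed

end

section \<open>Saturation in an extension of local rings\<close>

lemma is_primary_toD:
  assumes "is_primary_to R M I"
  shows "ideal I R" "radical R I = M"
  using assms by (simp_all add: is_primary_to_def primary_ideal_def)

lemma (in cring) maximal_ideal_primary:
  assumes "maximalideal M R"
  shows "radical R M = M" "is_primary_to R M M"
proof -
  interpret M: primeideal M R
    by (rule maximalideal_prime[OF assms])
  have "x \<in> M" if "x \<in> carrier R" "x [^] (k::nat) \<in> M" for x k
    using that(2)
  proof (induction k)
    case 0
    then show ?case
      using M.I_notcarr M.one_imp_carrier by auto
  next
    case (Suc k)
    then show ?case
      using M.I_prime[of "x [^] k" x] that(1) by auto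
  qed
  moreover have one: "x [^] (1::nat) \<in> M" if "x \<in> M" for x
    using that by auto
  ultimately show rad: "radical R M = M"
    using M.Icarr unfolding radical_def by blast
  have "a \<in> M \<or> (\<exists>k::nat. b [^] k \<in> M)" if "a \<in> carrier R" "b \<in> carrier R" "a \<otimes> b \<in> M" for a b
    using M.I_prime[OF that] one by blast
  then show "is_primary_to R M M"
    using M.is_ideal M.I_notcarr rad by (simp add: is_primary_to_def primary_ideal_def)
qed

lemma (in local_ring) power_subset_of_radical:
  assumes "ideal I R" "\<mm> \<subseteq> radical R I"
  shows "\<exists>k. ideal_power R \<mm> k \<subseteq> I"
proof -
  have "ideal \<mm> R"
    using max_ideal by (rule maximalideal.axioms)
  then obtain A where "A \<subseteq> carrier R" "finite A" "\<mm> = Idl A"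
    using finetely_gen by blast
  then show ?thesis
    using radical_finite_power_subset[of A I] genideal_self[of A] assms by auto
qed

text \<open>Some power of the maximal ideal lies in \<open>I\<close>, hence some power lies in \<open>I^k\<close>.\<close>

lemma (in local_ring) saturation_primary_power:
  assumes I: "is_primary_to R \<mm> I"
  shows "saturation R \<mm> (ideal_power R I k) = carrier R"
proof -
  have m: "ideal \<mm> R"
    using max_ideal by (rule maximalideal.axioms)
  note iI = is_primary_toD(1)[OF I]
  obtain j where "ideal_power R \<mm> j \<subseteq> I"
    using power_subset_of_radical[OF iI] is_primary_toD(2)[OF I] by blast
  then have "ideal_power R \<mm> (j * k) \<subseteq> ideal_power R I k"
    using ideal_power_mono ideal_power_mult[OF m] by blast
  then show ?thesis
    using saturation_eq_carrier_iff[OF m ideal_power_ideal[OF iI]] by blast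
qed

context local_ring_extension
begin

sublocale ring_hom_cring R S \<phi>
  by unfold_locales (rule hom)

lemma max_ideals: "ideal \<mm> R" "ideal \<nn> S"
  using R.max_ideal S.max_ideal by (auto intro: maximalideal.axioms)

lemma ext_max_subset: "ext \<mm> \<subseteq> \<nn>"
  using local_hom by (intro ext_subset max_ideals) auto

lemma radical_ext_max_iff:
  "radical S (ext \<mm>) = \<nn> \<longleftrightarrow> (\<exists>k. ideal_power S \<nn> k \<subseteq> ext \<mm>)"
proof
  assume "radical S (ext \<mm>) = \<nn>"
  then show "\<exists>k. ideal_power S \<nn> k \<subseteq> ext \<mm>"
    by (intro S.power_subset_of_radical ext_ideal R.ideal_subset_carrier max_ideals) simp
next
  assume "\<exists>k. ideal_power S \<nn> k \<subseteq> ext \<mm>"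
  then obtain k where k: "ideal_power S \<nn> k \<subseteq> ext \<mm>"
    by blast
  have n: "\<nn> \<subseteq> carrier S"
    by (rule S.ideal_subset_carrier[OF max_ideals(2)])
  have "\<nn> \<subseteq> radical S (ext \<mm>)"
  proof
    fix x assume x: "x \<in> \<nn>"
    have "x [^]\<^bsub>S\<^esub> k \<in> ext \<mm>"
      using S.nat_pow_mem_ideal_power[OF x n, of k] k by (rule subsetD[rotated])
    then show "x \<in> radical S (ext \<mm>)"
      using x n unfolding radical_def by blast
  qed
  moreover have "radical S (ext \<mm>) \<subseteq> radical S \<nn>"
    using ext_max_subset by (auto simp: radical_def)
  then have "radical S (ext \<mm>) \<subseteq> \<nn>"
    by (simp only: S.maximal_ideal_primary(1)[OF S.max_ideal])
  ultimately show "radical S (ext \<mm>) = \<nn>"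
    by (intro subset_antisym)
qed

text \<open>Both sides say that some power of \<open>\<nn>\<close> lies in \<open>I^kS\<close>, respectively in \<open>\<mm>S\<close>, and these
  ideals are cofinal: \<open>\<mm>^i S \<subseteq> I^k S \<subseteq> \<mm>S\<close> for some \<open>i\<close>.  The second inclusion fails for
  \<open>k = 0\<close>, where \<open>I^0 = R\<close>.\<close>

lemma saturation_ext_power_eq_carrier_iff:
  assumes I: "is_primary_to R \<mm> I" and k: "k \<noteq> 0"
  shows "saturation S \<nn> (ext (ideal_power R I k)) = carrier S \<longleftrightarrow> radical S (ext \<mm>) = \<nn>"
proof -
  note iI = is_primary_toD(1)[OF I] and rad = is_primary_toD(2)[OF I]
  have "x [^]\<^bsub>R\<^esub> (1::nat) \<in> I" if "x \<in> I" for x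
    using that ideal.Icarr[OF iI] by auto
  then have "I \<subseteq> \<mm>"
    unfolding rad[symmetric] radical_def using ideal.Icarr[OF iI] by blast
  moreover have "ideal_power R I k \<subseteq> I"
    using R.ideal_power_Suc_subset(2)[OF iI, of "k - 1"] k by simp
  ultimately have sub: "ext (ideal_power R I k) \<subseteq> ext \<mm>"
    by (intro ext_mono R.ideal_subset_carrier max_ideals) auto
  have "(\<exists>j. ideal_power S \<nn> j \<subseteq> ext (ideal_power R I k)) \<longleftrightarrow> (\<exists>j. ideal_power S \<nn> j \<subseteq> ext \<mm>)"
  proof
    assume "\<exists>j. ideal_power S \<nn> j \<subseteq> ext \<mm>"
    then obtain j where j: "ideal_power S \<nn> j \<subseteq> ext \<mm>" by blast
    obtain i where i: "ideal_power R \<mm> i \<subseteq> ideal_power R I k"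
      using R.saturation_primary_power[OF I, of k]
        R.saturation_eq_carrier_iff[OF max_ideals(1) R.ideal_power_ideal[OF iI]] by blast
    have "ideal_power S \<nn> (j * i) = ideal_power S (ideal_power S \<nn> j) i"
      by (simp add: S.ideal_power_mult max_ideals)
    also have "\<dots> \<subseteq> ideal_power S (ext \<mm>) i"
      by (intro S.ideal_power_mono j)
    also have "\<dots> = ext (ideal_power R \<mm> i)"
      by (simp add: ext_power max_ideals)
    also have "\<dots> \<subseteq> ext (ideal_power R I k)"
      by (intro ext_mono i R.ideal_subset_carrier R.ideal_power_ideal iI)
    finally show "\<exists>j. ideal_power S \<nn> j \<subseteq> ext (ideal_power R I k)" by blast
  qed (use sub in blast)
  then show ?thesis
    using S.saturation_eq_carrier_iff[OF max_ideals(2)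
        ext_ideal[OF R.ideal_subset_carrier[OF R.ideal_power_ideal[OF iI]]]]
    by (simp only: radical_ext_max_iff)
qed

lemma saturation_ext:
  assumes rad: "radical S (ext \<mm>) = \<nn>" and I: "ideal I R"
    and colon: "\<And>J. ideal J R \<Longrightarrow> ext (colon R I J) = colon S (ext I) (ext J)"
  shows "ext (saturation R \<mm> I) = saturation S \<nn> (ext I)"
proof
  obtain p where "ideal_power S \<nn> p \<subseteq> ext \<mm>"
    using rad radical_ext_max_iff by blast
  then show "ext (saturation R \<mm> I) \<subseteq> saturation S \<nn> (ext I)"
    by (intro ext_saturation_subset max_ideals I)
  show "saturation S \<nn> (ext I) \<subseteq> ext (saturation R \<mm> I)"
    by (intro saturation_subset_ext max_ideals I ext_max_subset) (simp add: colon)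
qed

lemma saturation_ext_primary_iff:
  assumes I: "is_primary_to R \<mm> I"
  shows "ext (saturation R \<mm> I) = saturation S \<nn> (ext I) \<longleftrightarrow> radical S (ext \<mm>) = \<nn>"
proof -
  have 1: "ideal_power R I (Suc 0) = I"
    by (rule R.ideal_power_1[OF is_primary_toD(1)[OF I]])
  have "ext (saturation R \<mm> I) = carrier S"
    using R.saturation_primary_power[OF I, of "Suc 0"] by (simp only: 1 ext_carrier)
  then show ?thesis
    using saturation_ext_power_eq_carrier_iff[OF I, of "Suc 0"] unfolding 1 by auto
qed

text \<open>The saturation of \<open>I^k\<close> is \<open>R\<close>, so the \<open>k\<close>-th term is the length of \<open>S\<close> modulo the
  saturation of \<open>I^kS\<close>, which for
  \<open>k > 0\<close> is zero exactly when the radical condition holds.  As lengths are extended natural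
  numbers, convergence to zero means that the terms are eventually equal to zero.\<close>

lemma length_tendsto_0_iff:
  assumes I: "is_primary_to R \<mm> I"
  shows "((\<lambda>k. module_length S
            (quotient_module (ideal_module S (ext (saturation R \<mm> (ideal_power R I k))))
              (saturation S \<nn> (ext (ideal_power R I k))))) \<longlonglongrightarrow> 0)
      \<longleftrightarrow> radical S (ext \<mm>) = \<nn>" (is "(?l \<longlonglongrightarrow> 0) \<longleftrightarrow> _")
proof -
  note iI = is_primary_toD(1)[OF I]
  have zero: "?l k = 0 \<longleftrightarrow> radical S (ext \<mm>) = \<nn>" if "k \<noteq> 0" for k
  proof -
    have "ideal (saturation S \<nn> (ext (ideal_power R I k))) S"
      by (intro S.saturation_ideal max_ideals ext_ideal R.ideal_subset_carrier R.ideal_power_ideal iI)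
    then show ?thesis
      unfolding R.saturation_primary_power[OF I] ext_carrier
        saturation_ext_power_eq_carrier_iff[OF I that, symmetric]
      by (rule S.length_quotient_eq_0_iff)
  qed
  have "\<exists>k. k \<noteq> 0 \<and> ?l k = 0" if "?l \<longlonglongrightarrow> 0"
  proof -
    have "eventually (\<lambda>k. ?l k < 1) sequentially"
      using order_tendstoD(2)[OF that, of 1] by simp
    then obtain K where "\<And>k. k \<ge> K \<Longrightarrow> ?l k < 1"
      by (auto simp: eventually_sequentially)
    from this[of "Suc K"] show ?thesis
      by (intro exI[of _ "Suc K"]) (simp add: one_eSuc zero_enat_def[symmetric])
  qed
  moreover have "?l \<longlonglongrightarrow> 0" if "radical S (ext \<mm>) = \<nn>"
    using zero that by (intro tendsto_eventually eventually_sequentiallyI[of 1]) auto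
  ultimately show ?thesis
    using zero by blast
qed

end

theorem theorem1p4:
  fixes R :: "('a, 'c) ring_scheme" and S :: "('b, 'd) ring_scheme"
    and \<mm> :: "'a set" and \<nn> :: "'b set" and \<phi> :: "'a \<Rightarrow> 'b"
  assumes "local_ring_extension R \<mm> S \<nn> \<phi>"
  shows "let
      ext = (\<lambda>I. Idl\<^bsub>S\<^esub> (\<phi> ` I));
      colon_compat = (\<forall>I J. ideal I R \<and> ideal J R \<longrightarrow>
        ext (colon R I J) = colon S (ext I) (ext J));
      cond_i = (\<forall>I. ideal I R \<longrightarrow> ext (saturation R \<mm> I) = saturation S \<nn> (ext I));
      cond_ii = (\<exists>I. is_primary_to R \<mm> I \<and> ext (saturation R \<mm> I) = saturation S \<nn> (ext I));
      cond_iii = (radical S (ext \<mm>) = \<nn>);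
      cond_iv = (\<exists>I. is_primary_to R \<mm> I \<and>
        ((\<lambda>k. module_length S
            (quotient_module (ideal_module S (ext (saturation R \<mm> (ideal_power R I k))))
              (saturation S \<nn> (ext (ideal_power R I k))))) \<longlonglongrightarrow> 0))
    in
      (colon_compat \<longrightarrow>
        (cond_i \<longleftrightarrow> cond_ii) \<and> (cond_ii \<longleftrightarrow> cond_iii) \<and> (cond_iii \<longleftrightarrow> cond_iv)) \<and>
      (flat_hom R S \<phi> \<longrightarrow> colon_compat) \<and>
      (etale R \<mm> S \<nn> \<phi> \<longrightarrow> cond_i)"
proof -
  interpret local_ring_extension R \<mm> S \<nn> \<phi> by fact
  have prim: "is_primary_to R \<mm> \<mm>"
    by (rule R.maximal_ideal_primary(2)[OF R.max_ideal])
  define compat where "compat \<longleftrightarrow> (\<forall>I J. ideal I R \<and> ideal J R \<longrightarrow>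
    ext (colon R I J) = colon S (ext I) (ext J))"
  define i where "i \<longleftrightarrow> (\<forall>I. ideal I R \<longrightarrow> ext (saturation R \<mm> I) = saturation S \<nn> (ext I))"
  define ii where "ii \<longleftrightarrow> (\<exists>I. is_primary_to R \<mm> I \<and> ext (saturation R \<mm> I) = saturation S \<nn> (ext I))"
  define iii where "iii \<longleftrightarrow> radical S (ext \<mm>) = \<nn>"
  define iv where "iv \<longleftrightarrow> (\<exists>I. is_primary_to R \<mm> I \<and>
        ((\<lambda>k. module_length S
            (quotient_module (ideal_module S (ext (saturation R \<mm> (ideal_power R I k))))
              (saturation S \<nn> (ext (ideal_power R I k))))) \<longlonglongrightarrow> 0))"
  have "i \<longrightarrow> ii"
    using prim max_ideals(1) unfolding i_def ii_def by blast
  moreover have "ii \<longleftrightarrow> iii"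
    using prim saturation_ext_primary_iff unfolding ii_def iii_def by blast
  moreover have iii_i: "i" if compat iii
    using that saturation_ext unfolding compat_def iii_def i_def by blast
  moreover have "iii \<longleftrightarrow> iv"
    using prim length_tendsto_0_iff unfolding iii_def iv_def by blast
  moreover have flat: "compat" if "flat_hom R S \<phi>"
    using flat_ext_colon[OF that R.noetherian_ring_axioms] unfolding compat_def by blast
  moreover have "i" if et: "etale R \<mm> S \<nn> \<phi>"
  proof (rule iii_i)
    show compat
      using et by (intro flat) (simp add: etale_def)
    have "ext \<mm> = \<nn>"
      using et by (simp add: etale_def unramified_def)
    then show iii
      using S.maximal_ideal_primary(1)[OF S.max_ideal] by (simp add: iii_def)
  qed
  ultimately show ?thesis
    unfolding Let_def compat_def i_def ii_def iii_def iv_def by blast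
qed

end
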